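(* Let $S\colon V_\infty\to V_\infty$ be the isometry $S\left((x_k)_{k=0}^\infty\right)=(0,A_0x_0,A_1x_1,A_2x_2,\dots)$. Let $e_{10}\in V_0$ be a unit vector; for each $k\ge1$ let $M_k$ be the orthogonal complement of $S(V_{k-1})$ in $V_k$ (which has dimension $2^{k-1}$) and let $\{e_{jk}\}_{j=1}^{2^{k-1}}$ be an orthonormal basis of $M_k$. Set $H_{jk}=\overline{\mathrm{span}}\{S^i(e_{jk})\mid i=0,1,2,\dots\}\subset V_\infty$ for $(j,k)=(1,0)$ and for $k\ge1$, $1\le j\le2^{k-1}$. Then: (1) The spaces $H_{10}$ and $H_{jk}$ ($k=1,2,\dots$, $j=1,\dots,2^{k-1}$) are $S$-invariant subspaces of $V_\infty$ isometrically isomorphic to $\ell_2$, and the restriction $S_{jk}$ of $S$ to $H_{jk}$ is the unilateral shift (with respect to $(S^i(e_{jk}))_{i\ge0}$). (2) $V_\infty$ is the (Hilbert space) direct sum of the spaces $H_{jk}$. (3) The operator $S$ is the direct sum of the copies $S_{jk}$ of the unilateral shift.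
   Context: $\mathbb{N}=\{0,1,2,\dots\}$. For any positive integer $m$ and $k\in\mathbb{N}$, $\omega_{m,k}=\exp\left(\frac{(2m-1)\pi i}{2^k}\right)$, and $\Omega_{m,k}\colon\mathbb{N}\to\mathbb{C}$ is the function $\Omega_{m,k}(n)=\omega_{m,k}^n$; both depend only on $m$ modulo $2^k$. $V_k$ is the complex vector space of functions spanned by $\Omega_{1,k},\dots,\Omega_{2^k,k}$ (which are linearly independent), with the inner product making $(\Omega_{j,k})_{j=1}^{2^k}$ an orthonormal basis. $A_k\colon V_k\to V_{k+1}$ is the (isometric) linear operator with $$A_k(\Omega_{j,k})=\tfrac12\Omega_{j,k+1}+\tfrac{\omega_{j,k+1}}{2}\Omega_{3j-1,k+1}+\tfrac12\Omega_{2^k+j,k+1}-\tfrac{\omega_{j,k+1}}{2}\Omega_{2^k+3j-1,k+1},\quad j=1,\dots,2^k.$$ $V_\infty=\bigoplus_{k=0}^\infty V_k$ is the Hilbert space direct sum; each $V_k$ is regarded as a subspace of $V_\infty$, so $S(V_{k-1})=A_{k-1}(V_{k-1})\subset V_k$. *)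

theory Defs
  imports "HOL-Analysis.Analysis" "HOL-Library.Function_Algebras"
begin

section \<open>Complex vector spaces of functions\<close>

class complex_vector = ab_group_add +
  fixes scaleC :: "complex \<Rightarrow> 'a \<Rightarrow> 'a" (infixr "*\<^sub>C" 75)
  assumes scaleC_add_right: "a *\<^sub>C (x + y) = a *\<^sub>C x + a *\<^sub>C y"
    and scaleC_add_left: "(a + b) *\<^sub>C x = a *\<^sub>C x + b *\<^sub>C x"
    and scaleC_scaleC: "a *\<^sub>C b *\<^sub>C x = (a * b) *\<^sub>C x"
    and scaleC_one: "1 *\<^sub>C x = x"

global_interpretation complex_vector: vector_space "scaleC :: complex \<Rightarrow> 'a \<Rightarrow> 'a::complex_vector"
  by unfold_locales (rule scaleC_add_right scaleC_add_left scaleC_scaleC scaleC_one)+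

abbreviation cspan :: "'a::complex_vector set \<Rightarrow> 'a set"
  where "cspan \<equiv> complex_vector.span"

abbreviation csubspace :: "'a::complex_vector set \<Rightarrow> bool"
  where "csubspace \<equiv> complex_vector.subspace"

instantiation complex :: complex_vector
begin

definition scaleC_complex :: "complex \<Rightarrow> complex \<Rightarrow> complex"
  where "scaleC_complex a x = a * x"

instance
  by standard (simp_all add: scaleC_complex_def algebra_simps)

end

instantiation "fun" :: (type, complex_vector) complex_vector
begin

definition scaleC_fun :: "complex \<Rightarrow> ('a \<Rightarrow> 'b) \<Rightarrow> 'a \<Rightarrow> 'b"
  where "scaleC_fun a f = (\<lambda>x. a *\<^sub>C f x)"

instance
  by standard
    (simp_all add: scaleC_fun_def fun_eq_iff scaleC_add_right scaleC_add_left scaleC_scaleC scaleC_one)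

end


section \<open>Inner products, isometries and Hilbert space direct sums\<close>

text \<open>
  A complex inner product space is given by a set of vectors together with an inner product
  \<open>p\<close> (linear in its first argument) whose values matter on that set only.
\<close>

definition ip_norm :: "('a \<Rightarrow> 'a \<Rightarrow> complex) \<Rightarrow> 'a \<Rightarrow> real"
  where "ip_norm p x = sqrt (Re (p x x))"

definition orthonormal_basis ::
    "('a::complex_vector \<Rightarrow> 'a \<Rightarrow> complex) \<Rightarrow> 'i set \<Rightarrow> ('i \<Rightarrow> 'a) \<Rightarrow> 'a set \<Rightarrow> bool"
  where "orthonormal_basis p J b W \<longleftrightarrow>
    (\<forall>i\<in>J. \<forall>j\<in>J. p (b i) (b j) = (if i = j then 1 else 0)) \<and> cspan (b ` J) = W"
  \<comment> \<open>algebraic span: only used for finite \<open>J\<close>\<close>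

definition isometric_iso ::
    "'a::complex_vector set \<Rightarrow> ('a \<Rightarrow> 'a \<Rightarrow> complex) \<Rightarrow>
     'b::complex_vector set \<Rightarrow> ('b \<Rightarrow> 'b \<Rightarrow> complex) \<Rightarrow> ('a \<Rightarrow> 'b) \<Rightarrow> bool"
  where "isometric_iso X p Y q T \<longleftrightarrow>
    bij_betw T X Y \<and>
    (\<forall>x\<in>X. \<forall>y\<in>X. T (x + y) = T x + T y) \<and>
    (\<forall>c. \<forall>x\<in>X. T (c *\<^sub>C x) = c *\<^sub>C T x) \<and>
    (\<forall>x\<in>X. ip_norm q (T x) = ip_norm p x)"

definition isometrically_isomorphic ::
    "'a::complex_vector set \<Rightarrow> ('a \<Rightarrow> 'a \<Rightarrow> complex) \<Rightarrow>
     'b::complex_vector set \<Rightarrow> ('b \<Rightarrow> 'b \<Rightarrow> complex) \<Rightarrow> bool"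
  where "isometrically_isomorphic X p Y q \<longleftrightarrow> (\<exists>T. isometric_iso X p Y q T)"

text \<open>
  The external Hilbert space direct sum of the spaces \<open>W i\<close>, \<open>i \<in> I\<close>. Families are set to \<open>0\<close>
  outside \<open>I\<close> so that they form a vector space under the pointwise operations.
\<close>

definition hsum :: "'i set \<Rightarrow> ('i \<Rightarrow> 'a::zero set) \<Rightarrow> ('i \<Rightarrow> 'a \<Rightarrow> 'a \<Rightarrow> complex) \<Rightarrow> ('i \<Rightarrow> 'a) set"
  where "hsum I W p = {u. (\<forall>i\<in>I. u i \<in> W i) \<and> (\<forall>i. i \<notin> I \<longrightarrow> u i = 0) \<and>
    (\<lambda>i. (ip_norm (p i) (u i))\<^sup>2) summable_on I}"

definition hsum_inner ::
    "'i set \<Rightarrow> ('i \<Rightarrow> 'a \<Rightarrow> 'a \<Rightarrow> complex) \<Rightarrow> ('i \<Rightarrow> 'a) \<Rightarrow> ('i \<Rightarrow> 'a) \<Rightarrow> complex"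
  where "hsum_inner I p u v = (\<Sum>\<^sub>\<infinity>i\<in>I. p i (u i) (v i))"

definition ell2 :: "(nat \<Rightarrow> complex) set"
  where "ell2 = hsum UNIV (\<lambda>_. UNIV) (\<lambda>_ a b. a * cnj b)"

definition ell2_inner :: "(nat \<Rightarrow> complex) \<Rightarrow> (nat \<Rightarrow> complex) \<Rightarrow> complex"
  where "ell2_inner = hsum_inner UNIV (\<lambda>_ a b. a * cnj b)"

definition ell2_unit :: "nat \<Rightarrow> nat \<Rightarrow> complex"
  where "ell2_unit i = (\<lambda>n. if n = i then 1 else 0)"

definition ell2_shift :: "(nat \<Rightarrow> complex) \<Rightarrow> nat \<Rightarrow> complex"
  where "ell2_shift a = (\<lambda>n. case n of 0 \<Rightarrow> 0 | Suc m \<Rightarrow> a m)"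

text \<open>
  \<open>R\<close> is the unilateral shift on the space \<open>(W, p)\<close> with respect to the sequence \<open>b\<close>: the
  identification of \<open>W\<close> with \<open>\<ell>\<^sub>2\<close> that carries \<open>b\<close> to the standard basis carries \<open>R\<close> to the
  shift \<open>(a\<^sub>0, a\<^sub>1, \<dots>) \<mapsto> (0, a\<^sub>0, a\<^sub>1, \<dots>)\<close>.
\<close>

definition unilateral_shift_wrt ::
    "'a::complex_vector set \<Rightarrow> ('a \<Rightarrow> 'a \<Rightarrow> complex) \<Rightarrow> (nat \<Rightarrow> 'a) \<Rightarrow> ('a \<Rightarrow> 'a) \<Rightarrow> bool"
  where "unilateral_shift_wrt W p b R \<longleftrightarrow>
    (\<exists>T. isometric_iso ell2 ell2_inner W p T \<and>
      (\<forall>i. T (ell2_unit i) = b i) \<and>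
      (\<forall>a\<in>ell2. R (T a) = T (ell2_shift a)))"

definition norm_closure ::
    "'a::complex_vector set \<Rightarrow> ('a \<Rightarrow> 'a \<Rightarrow> complex) \<Rightarrow> 'a set \<Rightarrow> 'a set"
  where "norm_closure X p B = {x \<in> X. \<forall>\<epsilon>>0. \<exists>y\<in>B. ip_norm p (x - y) < \<epsilon>}"

definition closed_subspace ::
    "'a::complex_vector set \<Rightarrow> ('a \<Rightarrow> 'a \<Rightarrow> complex) \<Rightarrow> 'a set \<Rightarrow> bool"
  where "closed_subspace X p W \<longleftrightarrow> W \<subseteq> X \<and> csubspace W \<and> norm_closure X p W = W"

definition norm_has_sum ::
    "('a::complex_vector \<Rightarrow> 'a \<Rightarrow> complex) \<Rightarrow> ('i \<Rightarrow> 'a) \<Rightarrow> 'i set \<Rightarrow> 'a \<Rightarrow> bool"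
  where "norm_has_sum p u I x \<longleftrightarrow>
    ((\<lambda>F. ip_norm p (sum u F - x)) \<longlongrightarrow> 0) (finite_subsets_at_top I)"

text \<open>
  \<open>U\<close> is the canonical map \<open>u \<mapsto> \<Sum>i\<in>I. u i\<close> from the external Hilbert direct sum of the closed
  subspaces \<open>W i\<close> to \<open>X\<close>, and it is an isometric isomorphism onto \<open>X\<close>.
\<close>

definition hilbert_sum_map ::
    "'a::complex_vector set \<Rightarrow> ('a \<Rightarrow> 'a \<Rightarrow> complex) \<Rightarrow> 'i set \<Rightarrow> ('i \<Rightarrow> 'a set) \<Rightarrow>
     (('i \<Rightarrow> 'a) \<Rightarrow> 'a) \<Rightarrow> bool"
  where "hilbert_sum_map X p I W U \<longleftrightarrow>
    (\<forall>i\<in>I. closed_subspace X p (W i)) \<and>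
    (\<forall>u\<in>hsum I W (\<lambda>_. p). norm_has_sum p u I (U u)) \<and>
    isometric_iso (hsum I W (\<lambda>_. p)) (hsum_inner I (\<lambda>_. p)) X p U"

definition is_hilbert_direct_sum ::
    "'a::complex_vector set \<Rightarrow> ('a \<Rightarrow> 'a \<Rightarrow> complex) \<Rightarrow> 'i set \<Rightarrow> ('i \<Rightarrow> 'a set) \<Rightarrow> bool"
  where "is_hilbert_direct_sum X p I W \<longleftrightarrow> (\<exists>U. hilbert_sum_map X p I W U)"

text \<open>
  \<open>T\<close> is the direct sum of the operators \<open>R i\<close> on \<open>W i\<close>: under the canonical identification of
  \<open>X\<close> with the Hilbert direct sum of the \<open>W i\<close>, it acts as \<open>(u\<^sub>i)\<^sub>i \<mapsto> (R\<^sub>i u\<^sub>i)\<^sub>i\<close>.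
\<close>

definition is_operator_direct_sum ::
    "'a::complex_vector set \<Rightarrow> ('a \<Rightarrow> 'a \<Rightarrow> complex) \<Rightarrow> 'i set \<Rightarrow> ('i \<Rightarrow> 'a set) \<Rightarrow>
     ('i \<Rightarrow> 'a \<Rightarrow> 'a) \<Rightarrow> ('a \<Rightarrow> 'a) \<Rightarrow> bool"
  where "is_operator_direct_sum X p I W R T \<longleftrightarrow>
    (\<exists>U. hilbert_sum_map X p I W U \<and>
      (\<forall>u\<in>hsum I W (\<lambda>_. p).
        (\<lambda>i. if i \<in> I then R i (u i) else 0) \<in> hsum I W (\<lambda>_. p) \<and>
        T (U u) = U (\<lambda>i. if i \<in> I then R i (u i) else 0)))"


section \<open>The spaces \<open>V\<^sub>k\<close> and the operators \<open>A\<^sub>k\<close>\<close>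

definition omega :: "nat \<Rightarrow> nat \<Rightarrow> complex"
  where "omega m k = exp ((2 * of_nat m - 1) * of_real pi * \<i> / 2 ^ k)"

definition Omega :: "nat \<Rightarrow> nat \<Rightarrow> nat \<Rightarrow> complex"
  where "Omega m k = (\<lambda>n. omega m k ^ n)"

definition Omega_basis :: "nat \<Rightarrow> (nat \<Rightarrow> complex) set"
  where "Omega_basis k = (\<lambda>j. Omega j k) ` {1..2 ^ k}"

definition V :: "nat \<Rightarrow> (nat \<Rightarrow> complex) set"
  where "V k = cspan (Omega_basis k)"

text \<open>
  The \<open>j\<close>-th coordinate of \<open>f \<in> V k\<close>; \<open>representation\<close> is meaningful because \<open>Omega_basis k\<close> is
  linearly independent and \<open>j \<mapsto> Omega j k\<close> is injective on \<open>{1..2 ^ k}\<close> (shown below).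
\<close>

definition coord :: "nat \<Rightarrow> (nat \<Rightarrow> complex) \<Rightarrow> nat \<Rightarrow> complex"
  where "coord k f j = complex_vector.representation (Omega_basis k) f (Omega j k)"

definition V_inner :: "nat \<Rightarrow> (nat \<Rightarrow> complex) \<Rightarrow> (nat \<Rightarrow> complex) \<Rightarrow> complex"
  where "V_inner k f g = (\<Sum>j = 1..2 ^ k. coord k f j * cnj (coord k g j))"

definition A_Omega :: "nat \<Rightarrow> nat \<Rightarrow> nat \<Rightarrow> complex"
  where "A_Omega k j =
    (1 / 2) *\<^sub>C Omega j (k + 1) + (omega j (k + 1) / 2) *\<^sub>C Omega (3 * j - 1) (k + 1)
    + (1 / 2) *\<^sub>C Omega (2 ^ k + j) (k + 1)
    - (omega j (k + 1) / 2) *\<^sub>C Omega (2 ^ k + 3 * j - 1) (k + 1)"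

definition A :: "nat \<Rightarrow> (nat \<Rightarrow> complex) \<Rightarrow> nat \<Rightarrow> complex"
  where "A k f = (\<Sum>j = 1..2 ^ k. coord k f j *\<^sub>C A_Omega k j)"


section \<open>The space \<open>V\<^sub>\<infinity>\<close> and the operator \<open>S\<close>\<close>

definition V_inf :: "(nat \<Rightarrow> nat \<Rightarrow> complex) set"
  where "V_inf = hsum UNIV V V_inner"

definition V_inf_inner :: "(nat \<Rightarrow> nat \<Rightarrow> complex) \<Rightarrow> (nat \<Rightarrow> nat \<Rightarrow> complex) \<Rightarrow> complex"
  where "V_inf_inner = hsum_inner UNIV V_inner"

text \<open>\<open>V k\<close> regarded as a subspace of \<open>V_inf\<close>.\<close>

definition V_in :: "nat \<Rightarrow> (nat \<Rightarrow> nat \<Rightarrow> complex) set"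
  where "V_in k = (\<lambda>f i. if i = k then f else 0) ` V k"

definition S :: "(nat \<Rightarrow> nat \<Rightarrow> complex) \<Rightarrow> nat \<Rightarrow> nat \<Rightarrow> complex"
  where "S x = (\<lambda>k. case k of 0 \<Rightarrow> 0 | Suc i \<Rightarrow> A i (x i))"

text \<open>Only meaningful for \<open>k \<ge> 1\<close>.\<close>

definition M :: "nat \<Rightarrow> (nat \<Rightarrow> nat \<Rightarrow> complex) set"
  where "M k = {x \<in> V_in k. \<forall>y \<in> S ` V_in (k - 1). V_inf_inner x y = 0}"

definition closed_span :: "(nat \<Rightarrow> nat \<Rightarrow> complex) set \<Rightarrow> (nat \<Rightarrow> nat \<Rightarrow> complex) set"
  where "closed_span B = norm_closure V_inf V_inf_inner (cspan B)"

definition index_set :: "(nat \<times> nat) set"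
  where "index_set = {(1, 0)} \<union> {(j, k). 1 \<le> k \<and> 1 \<le> j \<and> j \<le> 2 ^ (k - 1)}"


section \<open>Well-definedness of the coordinates\<close>

lemma omega_inj_on: "inj_on (\<lambda>j. omega j k) {1..2 ^ k}"
proof (rule inj_onI)
  fix a b :: nat
  assume a: "a \<in> {1..2 ^ k}" and b: "b \<in> {1..2 ^ k}" and eq: "omega a k = omega b k"
  obtain n :: int where
    n: "(2 * of_nat a - 1) * complex_of_real pi * \<i> / 2 ^ k
      = (2 * of_nat b - 1) * of_real pi * \<i> / 2 ^ k + of_int (2 * n) * of_real pi * \<i>"
    using eq unfolding omega_def exp_eq by auto
  have "((2 * of_nat a - 1) / 2 ^ k) * (complex_of_real pi * \<i>)
      = ((2 * of_nat b - 1) / 2 ^ k + of_int (2 * n)) * (of_real pi * \<i>)"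
    using n by (simp add: algebra_simps)
  then have "(2 * of_nat a - 1) / 2 ^ k = (2 * of_nat b - 1) / 2 ^ k + (of_int (2 * n) :: complex)"
    by (subst (asm) mult_right_cancel) auto
  then have "2 * (of_nat a :: complex) = 2 * (of_nat b + of_int n * 2 ^ k)"
    by (simp add: field_simps)
  then have "(of_nat a :: complex) = of_nat b + of_int n * 2 ^ k"
    by (simp only: mult_cancel_left) simp
  then have "(of_int (int a) :: complex) = of_int (int b + n * 2 ^ k)"
    by simp
  then have ab: "int a = int b + n * 2 ^ k"
    by (simp only: of_int_eq_iff)
  have "\<bar>int a - int b\<bar> < 2 ^ k"
  proof -
    have "int a \<le> int (2 ^ k)" "int b \<le> int (2 ^ k)" "1 \<le> int a" "1 \<le> int b"
      using a b by (simp_all only: of_nat_le_iff atLeastAtMost_iff) simp_all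
    moreover have "int (2 ^ k) = 2 ^ k"
      by simp
    ultimately show ?thesis
      by linarith
  qed
  then have "\<bar>n\<bar> * 2 ^ k < 1 * 2 ^ k"
    using ab by (simp add: abs_mult)
  then have "\<bar>n\<bar> < 1"
    by (simp only: mult_less_cancel_right) auto
  then show "a = b"
    using ab by simp
qed

lemma Omega_inj_on: "inj_on (\<lambda>j. Omega j k) {1..2 ^ k}"
proof (rule inj_onI)
  fix a b :: nat
  assume a: "a \<in> {1..2 ^ k}" and b: "b \<in> {1..2 ^ k}" and eq: "Omega a k = Omega b k"
  from fun_cong[OF eq, of 1] have "omega a k = omega b k"
    by (simp add: Omega_def)
  then show "a = b"
    using inj_onD[OF omega_inj_on _ a b] by simp
qed

lemma power_sequences_independent:
  fixes w :: "'i \<Rightarrow> complex"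
  assumes J: "finite J" "inj_on w J" and l: "l \<in> J"
    and zero: "\<And>n. (\<Sum>j\<in>J. c j * w j ^ n) = 0"
  shows "c l = 0"
proof -
  define q where "q = (\<Prod>j\<in>J - {l}. [:- w j, 1:])"
  have poly_zero: "(\<Sum>j\<in>J. c j * poly r (w j)) = 0" for r
  proof -
    have "(\<Sum>j\<in>J. c j * poly r (w j)) = (\<Sum>j\<in>J. \<Sum>i\<le>degree r. coeff r i * (c j * w j ^ i))"
      by (simp add: poly_altdef sum_distrib_left mult_ac)
    also have "\<dots> = (\<Sum>i\<le>degree r. coeff r i * (\<Sum>j\<in>J. c j * w j ^ i))"
      by (subst sum.swap) (simp add: sum_distrib_left)
    finally show ?thesis
      by (simp add: zero)
  qed
  have q0: "poly q (w j) = 0" if "j \<in> J - {l}" for j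
    using that J by (auto simp: q_def poly_prod prod_zero_iff)
  have ql: "poly q (w l) \<noteq> 0"
    using J l by (auto simp: q_def poly_prod prod_zero_iff dest: inj_onD)
  have "(\<Sum>j\<in>J. c j * poly q (w j)) = c l * poly q (w l) + (\<Sum>j\<in>J - {l}. c j * poly q (w j))"
    using J l by (simp add: sum.remove)
  also have "(\<Sum>j\<in>J - {l}. c j * poly q (w j)) = 0"
    using q0 by (intro sum.neutral) auto
  finally show ?thesis
    using poly_zero[of q] ql by simp
qed

lemma sum_fun_apply: "(\<Sum>i\<in>I. (f i :: 'a \<Rightarrow> 'b::comm_monoid_add)) x = (\<Sum>i\<in>I. f i x)"
  by (induction I rule: infinite_finite_induct) auto

lemma independent_Omega_basis: "complex_vector.independent (Omega_basis k)"
proof -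
  have fin: "finite (Omega_basis k)"
    by (simp add: Omega_basis_def)
  have "u (Omega l k) = 0"
    if u: "(\<Sum>v\<in>Omega_basis k. u v *\<^sub>C v) = 0" and l: "l \<in> {1..2 ^ k}" for u l
  proof (rule power_sequences_independent[where c = "\<lambda>j. u (Omega j k)"
        and w = "\<lambda>j. omega j k" and J = "{1..2 ^ k}"])
    fix n
    have "(\<Sum>j = 1..2 ^ k. u (Omega j k) *\<^sub>C Omega j k) = 0"
      using u unfolding Omega_basis_def sum.reindex[OF Omega_inj_on] o_def .
    from fun_cong[OF this, of n]
    show "(\<Sum>j = 1..2 ^ k. u (Omega j k) * omega j k ^ n) = 0"
      by (simp add: sum_fun_apply scaleC_fun_def scaleC_complex_def Omega_def)
  qed (use l omega_inj_on in auto)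
  then show ?thesis
    unfolding complex_vector.dependent_finite[OF fin] by (auto simp: Omega_basis_def)
qed

lemma coord_Omega:
  assumes "i \<in> {1..2 ^ k}" "j \<in> {1..2 ^ k}"
  shows "coord k (Omega i k) j = (if i = j then 1 else 0)"
proof -
  have "Omega i k \<in> Omega_basis k"
    using assms by (simp add: Omega_basis_def)
  then show ?thesis
    using inj_onD[OF Omega_inj_on _ assms]
    by (auto simp: coord_def complex_vector.representation_basis[OF independent_Omega_basis])
qed

lemma V_inner_Omega:
  assumes "i \<in> {1..2 ^ k}" "j \<in> {1..2 ^ k}"
  shows "V_inner k (Omega i k) (Omega j k) = (if i = j then 1 else 0)"
proof -
  have "V_inner k (Omega i k) (Omega j k)
      = (\<Sum>l = 1..2 ^ k. if l = i then (if i = j then 1 else 0) else 0)"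
    unfolding V_inner_def using assms by (intro sum.cong) (auto simp: coord_Omega)
  then show ?thesis
    using assms by simp
qed

lemma A_Omega:
  assumes "j \<in> {1..2 ^ k}"
  shows "A k (Omega j k) = A_Omega k j"
proof -
  have "A k (Omega j k) = (\<Sum>l = 1..2 ^ k. if l = j then A_Omega k j else 0)"
    unfolding A_def using assms by (intro sum.cong) (auto simp: coord_Omega scaleC_one)
  then show ?thesis
    using assms by simp
qed

lemma coord_add: "f \<in> V k \<Longrightarrow> g \<in> V k \<Longrightarrow> coord k (f + g) j = coord k f j + coord k g j"
  and coord_scaleC: "f \<in> V k \<Longrightarrow> coord k (c *\<^sub>C f) j = c * coord k f j"
  by (simp_all add: coord_def V_def complex_vector.representation_add[OF independent_Omega_basis]
      complex_vector.representation_scale[OF independent_Omega_basis])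

lemma A_add: "f \<in> V k \<Longrightarrow> g \<in> V k \<Longrightarrow> A k (f + g) = A k f + A k g"
  and A_scaleC: "f \<in> V k \<Longrightarrow> A k (c *\<^sub>C f) = c *\<^sub>C A k f"
  by (simp_all add: A_def coord_add coord_scaleC scaleC_add_left sum.distrib scaleC_scaleC
      complex_vector.scale_sum_right)

end

theory Submission
  imports Defs
begin

text \<open>
  The spaces \<open>V k\<close> are finite-dimensional and \<open>S\<close> carries level \<open>k\<close> isometrically into level
  \<open>k + 1\<close>. This makes the statement the Wold decomposition of a pure isometry, in a graded form
  where it can be proved one level at a time, as a matter of bookkeeping with orthonormal bases.

  That \<open>A k\<close> is an isometry is seen by grouping the four terms of \<open>A_Omega k j\<close>. With
  \<open>N = 2 ^ k\<close>, the sums \<open>\<Omega>\<^sub>m + \<Omega>\<^sub>m\<^sub>+\<^sub>N\<close> and the differences \<open>\<Omega>\<^sub>m - \<Omega>\<^sub>m\<^sub>+\<^sub>N\<close> are orthogonal to each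
  other, both depend up to sign only on \<open>m\<close> modulo \<open>N\<close>, and \<open>A_Omega k j\<close> combines the sum for
  \<open>m = j\<close> with the difference for \<open>m = 3 j - 1\<close>. As 3 is coprime to \<open>N\<close>, distinct \<open>j\<close> use
  distinct sums and distinct differences (\<open>A_Omega_orthonormal\<close>, \<open>A_isometric\<close>).

  Consequently, if \<open>B\<close> is an orthonormal basis of \<open>V k\<close>, then \<open>A k ` B\<close> together with an
  orthonormal basis of the orthogonal complement of \<open>A k ` V k\<close> is one of \<open>V (k + 1)\<close>
  (\<open>orthonormal_basis_Suc\<close>). By induction the vectors \<open>S\<^sup>n\<^sup>-\<^sup>k e\<^sub>j\<^sub>k\<close> with \<open>k \<le> n\<close> form an orthonormal
  basis of level \<open>n\<close>, for every \<open>n\<close>.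

  Given such bases, every element of \<open>V_inf\<close> is an array of square-summable coefficients, and
  everything can be read off from it. The closed span of the orbit of \<open>e\<^sub>j\<^sub>k\<close> consists of
  the vectors whose coefficients along all other orbits vanish (\<open>closed_span_orbit\<close>). The coefficients
  that remain form one \<open>\<ell>\<^sub>2\<close> sequence, which \<open>S\<close> shifts by one place (\<open>S_orbit_sum\<close>). The canonical
  map from the Hilbert sum of the orbit spaces to \<open>V_inf\<close> is a finite sum on every level, and
  Parseval's identity on the levels together with an interchange of two nonnegative sums shows that
  it is isometric and onto (\<open>hilbert_sum_map_levelwise_sum\<close>).
\<close>

section \<open>Linear algebra in the spaces \<open>V k\<close>\<close>

lemma csubspace_V: "csubspace (V k)"
  by (simp add: V_def)

lemma V_zero [simp]: "0 \<in> V k"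
  and V_add: "f \<in> V k \<Longrightarrow> g \<in> V k \<Longrightarrow> f + g \<in> V k"
  and V_diff: "f \<in> V k \<Longrightarrow> g \<in> V k \<Longrightarrow> f - g \<in> V k"
  and V_scaleC: "f \<in> V k \<Longrightarrow> c *\<^sub>C f \<in> V k"
  and V_sum: "(\<And>i. i \<in> I \<Longrightarrow> h i \<in> V k) \<Longrightarrow> sum h I \<in> V k"
  using csubspace_V[of k]
  by (auto simp: complex_vector.subspace_0 complex_vector.subspace_add complex_vector.subspace_diff
      complex_vector.subspace_scale complex_vector.subspace_sum)

lemma coord_zero [simp]: "coord k 0 j = 0"
  by (simp add: coord_def complex_vector.representation_zero)

lemma coord_diff: "f \<in> V k \<Longrightarrow> g \<in> V k \<Longrightarrow> coord k (f - g) j = coord k f j - coord k g j"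
  by (simp add: coord_def V_def complex_vector.representation_diff[OF independent_Omega_basis])

lemma V_expansion:
  assumes "f \<in> V k"
  shows "f = (\<Sum>j = 1..2 ^ k. coord k f j *\<^sub>C Omega j k)"
proof -
  have "f = (\<Sum>v\<in>Omega_basis k. complex_vector.representation (Omega_basis k) f v *\<^sub>C v)"
    using assms complex_vector.sum_representation_eq[OF independent_Omega_basis, of f k "Omega_basis k"]
    by (simp add: V_def) (simp add: Omega_basis_def)
  then show ?thesis
    unfolding Omega_basis_def sum.reindex[OF Omega_inj_on] o_def
    by (simp add: coord_def Omega_basis_def)
qed

lemma V_inner_add_left: "f \<in> V k \<Longrightarrow> g \<in> V k \<Longrightarrow> V_inner k (f + g) h = V_inner k f h + V_inner k g h"
  and V_inner_add_right: "f \<in> V k \<Longrightarrow> g \<in> V k \<Longrightarrow> V_inner k h (f + g) = V_inner k h f + V_inner k h g"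
  and V_inner_diff_left: "f \<in> V k \<Longrightarrow> g \<in> V k \<Longrightarrow> V_inner k (f - g) h = V_inner k f h - V_inner k g h"
  and V_inner_diff_right: "f \<in> V k \<Longrightarrow> g \<in> V k \<Longrightarrow> V_inner k h (f - g) = V_inner k h f - V_inner k h g"
  and V_inner_scaleC_left: "f \<in> V k \<Longrightarrow> V_inner k (c *\<^sub>C f) h = c * V_inner k f h"
  and V_inner_scaleC_right: "f \<in> V k \<Longrightarrow> V_inner k h (c *\<^sub>C f) = cnj c * V_inner k h f"
  by (simp_all add: V_inner_def coord_add coord_diff coord_scaleC algebra_simps sum.distrib
      sum_subtractf sum_distrib_left)

lemma V_inner_zero_left [simp]: "V_inner k 0 h = 0"
  and V_inner_zero_right [simp]: "V_inner k h 0 = 0"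
  by (simp_all add: V_inner_def)

lemma V_inner_commute: "V_inner k g f = cnj (V_inner k f g)"
  by (simp add: V_inner_def mult.commute)

lemma V_inner_sum_left:
  assumes "\<And>i. i \<in> I \<Longrightarrow> f i \<in> V k"
  shows "V_inner k (\<Sum>i\<in>I. c i *\<^sub>C f i) h = (\<Sum>i\<in>I. c i * V_inner k (f i) h)"
  using assms
  by (induction I rule: infinite_finite_induct)
     (auto simp: V_inner_add_left V_inner_scaleC_left V_sum V_scaleC)

lemma V_inner_sum_right:
  assumes "\<And>i. i \<in> I \<Longrightarrow> f i \<in> V k"
  shows "V_inner k h (\<Sum>i\<in>I. c i *\<^sub>C f i) = (\<Sum>i\<in>I. cnj (c i) * V_inner k h (f i))"
  using assms
  by (induction I rule: infinite_finite_induct)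
     (auto simp: V_inner_add_right V_inner_scaleC_right V_sum V_scaleC)

lemma V_inner_self_sum: "V_inner k f f = of_real (\<Sum>j = 1..2 ^ k. (cmod (coord k f j))\<^sup>2)"
  unfolding V_inner_def of_real_sum complex_norm_square ..

lemma V_norm_sq: "(ip_norm (V_inner k) f)\<^sup>2 = (\<Sum>j = 1..2 ^ k. (cmod (coord k f j))\<^sup>2)"
  unfolding ip_norm_def V_inner_self_sum by (simp add: sum_nonneg)

lemma V_inner_self: "V_inner k f f = of_real ((ip_norm (V_inner k) f)\<^sup>2)"
  unfolding V_norm_sq V_inner_self_sum ..

lemma V_norm_nonneg [simp]: "0 \<le> ip_norm (V_inner k) f"
  by (metis V_inner_self Re_complex_of_real ip_norm_def real_sqrt_ge_0_iff zero_le_power2)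

lemma V_norm_zero [simp]: "ip_norm (V_inner k) 0 = 0"
  by (simp add: ip_norm_def)

lemma V_norm_scaleC: "f \<in> V k \<Longrightarrow> ip_norm (V_inner k) (c *\<^sub>C f) = cmod c * ip_norm (V_inner k) f"
  by (rule power2_eq_imp_eq)
     (simp_all add: V_norm_sq power_mult_distrib coord_scaleC norm_mult sum_distrib_left)

text \<open>
  A weak form of the parallelogram law, from which sums of square-summable families are seen to be
  square-summable.
\<close>

lemma cmod_add_sq_le: "(cmod (a + b))\<^sup>2 \<le> 2 * ((cmod a)\<^sup>2 + (cmod b)\<^sup>2)"
proof -
  have "(cmod (a + b))\<^sup>2 \<le> (cmod a + cmod b)\<^sup>2"
    by (simp add: norm_triangle_ineq power_mono)
  also have "\<dots> \<le> 2 * ((cmod a)\<^sup>2 + (cmod b)\<^sup>2)"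
    using zero_le_power2[of "cmod a - cmod b"] by (simp add: power2_eq_square algebra_simps)
  finally show ?thesis .
qed

lemma V_norm_add_sq_le:
  assumes "f \<in> V k" "g \<in> V k"
  shows "(ip_norm (V_inner k) (f + g))\<^sup>2
    \<le> 2 * ((ip_norm (V_inner k) f)\<^sup>2 + (ip_norm (V_inner k) g)\<^sup>2)"
proof -
  have "(\<Sum>j = 1..2 ^ k. (cmod (coord k f j + coord k g j))\<^sup>2)
    \<le> (\<Sum>j = 1..2 ^ k. 2 * ((cmod (coord k f j))\<^sup>2 + (cmod (coord k g j))\<^sup>2))"
    by (intro sum_mono cmod_add_sq_le)
  also have "\<dots> = 2 * ((\<Sum>j = 1..2 ^ k. (cmod (coord k f j))\<^sup>2) + (\<Sum>j = 1..2 ^ k. (cmod (coord k g j))\<^sup>2))"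
    by (simp only: sum_distrib_left sum.distrib distrib_left)
  finally show ?thesis
    unfolding V_norm_sq coord_add[OF assms] .
qed

section \<open>Orthonormal bases of a level\<close>

context
  fixes k :: nat and J :: "'i set" and b :: "'i \<Rightarrow> nat \<Rightarrow> complex"
  assumes fin: "finite J" and onb: "orthonormal_basis (V_inner k) J b (V k)"
begin

lemma onb_mem: "q \<in> J \<Longrightarrow> b q \<in> V k"
  using onb complex_vector.span_superset[of "b ` J"] by (auto simp: orthonormal_basis_def)

lemma onb_inner: "q \<in> J \<Longrightarrow> r \<in> J \<Longrightarrow> V_inner k (b q) (b r) = (if q = r then 1 else 0)"
  using onb by (auto simp: orthonormal_basis_def)

text \<open>
  The vectors that satisfy the expansion form a subspace containing the basis, hence contain its
  span.
\<close>

lemma onb_expansion: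
  assumes "f \<in> V k"
  shows "f = (\<Sum>q\<in>J. V_inner k f (b q) *\<^sub>C b q)"
proof -
  define E where "E = {f \<in> V k. f = (\<Sum>q\<in>J. V_inner k f (b q) *\<^sub>C b q)}"
  have "cspan (b ` J) \<subseteq> E"
  proof (rule complex_vector.span_minimal)
    have "b r = (\<Sum>q\<in>J. V_inner k (b r) (b q) *\<^sub>C b q)" if "r \<in> J" for r
    proof -
      have "(\<Sum>q\<in>J. V_inner k (b r) (b q) *\<^sub>C b q) = (\<Sum>q\<in>J. if q = r then b r else 0)"
        using that by (intro sum.cong) (auto simp: onb_inner scaleC_one)
      then show ?thesis
        using fin that by simp
    qed
    then show "b ` J \<subseteq> E"
      by (auto simp: E_def onb_mem)
    show "csubspace E"
    proof (rule complex_vector.subspaceI)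
      show "0 \<in> E"
        by (simp add: E_def)
    next
      fix f g
      assume "f \<in> E" "g \<in> E"
      then show "f + g \<in> E"
        by (simp add: E_def V_add V_inner_add_left scaleC_add_left sum.distrib)
    next
      fix c f
      assume "f \<in> E"
      then have f: "f \<in> V k" "f = (\<Sum>q\<in>J. V_inner k f (b q) *\<^sub>C b q)"
        by (auto simp: E_def)
      have "c *\<^sub>C f = (\<Sum>q\<in>J. c *\<^sub>C V_inner k f (b q) *\<^sub>C b q)"
        by (subst f(2)) (rule complex_vector.scale_sum_right)
      also have "\<dots> = (\<Sum>q\<in>J. V_inner k (c *\<^sub>C f) (b q) *\<^sub>C b q)"
        using f(1) by (simp add: V_inner_scaleC_left scaleC_scaleC)
      finally show "c *\<^sub>C f \<in> E"
        using f(1) by (simp add: E_def V_scaleC)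
    qed
  qed
  then show ?thesis
    using assms onb by (auto simp: orthonormal_basis_def E_def)
qed

lemma onb_norm_sum:
  "(ip_norm (V_inner k) (\<Sum>q\<in>J. c q *\<^sub>C b q))\<^sup>2 = (\<Sum>q\<in>J. (cmod (c q))\<^sup>2)"
proof -
  have "V_inner k (\<Sum>q\<in>J. c q *\<^sub>C b q) (\<Sum>r\<in>J. c r *\<^sub>C b r)
      = (\<Sum>q\<in>J. c q * (\<Sum>r\<in>J. cnj (c r) * V_inner k (b q) (b r)))"
    by (subst V_inner_sum_left) (simp_all add: V_inner_sum_right onb_mem)
  also have "\<dots> = (\<Sum>q\<in>J. c q * (\<Sum>r\<in>J. if r = q then cnj (c q) else 0))"
    by (intro sum.cong refl arg_cong2[where f = times]) (auto simp: onb_inner)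
  also have "\<dots> = of_real (\<Sum>q\<in>J. (cmod (c q))\<^sup>2)"
    using fin unfolding of_real_sum complex_norm_square by simp
  finally show ?thesis
    unfolding V_inner_self of_real_eq_iff .
qed

lemma onb_parseval:
  assumes "f \<in> V k"
  shows "(ip_norm (V_inner k) f)\<^sup>2 = (\<Sum>q\<in>J. (cmod (V_inner k f (b q)))\<^sup>2)"
  using onb_norm_sum[of "\<lambda>q. V_inner k f (b q)"] onb_expansion[OF assms] by simp

lemma onb_coefficient_le:
  assumes "f \<in> V k" "q \<in> J"
  shows "cmod (V_inner k f (b q)) \<le> ip_norm (V_inner k) f"
proof (rule power2_le_imp_le)
  show "(cmod (V_inner k f (b q)))\<^sup>2 \<le> (ip_norm (V_inner k) f)\<^sup>2"
    unfolding onb_parseval[OF assms(1)] using assms(2) fin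
    by (intro member_le_sum) auto
qed simp

end

section \<open>The operators \<open>A k\<close> are isometries\<close>

lemma Omega_periodic: "Omega (m + t * 2 ^ k) k = Omega m k"
proof (induction t)
  case (Suc t)
  have "omega (m + 2 ^ k) k = omega m k" for m
  proof -
    have "(2 * of_nat (m + 2 ^ k) - 1) * of_real pi * \<i> / 2 ^ k
        = (2 * of_nat m - 1) * of_real pi * \<i> / 2 ^ k + 2 * of_real pi * \<i>"
      by (simp add: field_simps)
    then show ?thesis
      unfolding omega_def by (simp add: exp_add)
  qed
  from this[of "m + t * 2 ^ k"] Suc.IH show ?case
    by (simp add: Omega_def algebra_simps)
qed simp

text \<open>
  The indices \<open>3 * j - 1\<close> and \<open>2 ^ k + 3 * j - 1\<close> in the definition of \<open>A_Omega\<close> may exceed the range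
  \<open>{1..2 ^ (k + 1)}\<close> on which the functions \<open>Omega\<close> are the chosen basis, so they have to be
  reduced before coordinates can be taken.
\<close>

lemma Omega_representative:
  obtains r where "r \<in> {1..2 ^ k}" "Omega m k = Omega r k" "r mod 2 ^ k = m mod 2 ^ k"
proof -
  have per: "Omega (m mod 2 ^ k) k = Omega m k"
    using Omega_periodic[of "m mod 2 ^ k" "m div 2 ^ k" k]
    by (simp only: mod_div_mult_eq)
  show thesis
  proof (cases "m mod 2 ^ k = 0")
    case True
    then show thesis
      using that[of "2 ^ k"] per Omega_periodic[of 0 1 k] by simp
  next
    case False
    then show thesis
      using that[of "m mod 2 ^ k"] per
      by (metis atLeastAtMost_iff less_imp_le mod_less_divisor mod_mod_trivial not_less_eq_eq
          One_nat_def pos2 zero_less_power le_zero_eq)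
  qed
qed

lemma Omega_in_V: "Omega m k \<in> V k"
proof -
  obtain r where "r \<in> {1..2 ^ k}" "Omega m k = Omega r k"
    using Omega_representative .
  then show ?thesis
    unfolding V_def by (auto simp: Omega_basis_def intro: complex_vector.span_base)
qed

lemma V_inner_Omega_mod:
  "V_inner k (Omega m k) (Omega n k) = (if m mod 2 ^ k = n mod 2 ^ k then 1 else 0)"
proof -
  obtain r where r: "r \<in> {1..2 ^ k}" "Omega m k = Omega r k" "r mod 2 ^ k = m mod 2 ^ k"
    using Omega_representative .
  obtain s where s: "s \<in> {1..2 ^ k}" "Omega n k = Omega s k" "s mod 2 ^ k = n mod 2 ^ k"
    using Omega_representative .
  have "r = s" if "r mod 2 ^ k = s mod 2 ^ k"
  proof (cases "r = 2 ^ k \<or> s = 2 ^ k")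
    case True
    then show ?thesis
      using that r(1) s(1) by (metis atLeastAtMost_iff le_antisym mod_less mod_self nat_less_le
          not_one_le_zero)
  next
    case False
    then show ?thesis
      using that r(1) s(1) by simp
  qed
  then show ?thesis
    using V_inner_Omega[OF r(1) s(1)] r s by auto
qed

lemma cmod_omega: "cmod (omega m k) = 1"
proof -
  have "omega m k = exp (\<i> * of_real ((2 * of_nat m - 1) * pi / 2 ^ k))"
    by (simp add: omega_def mult_ac)
  then show ?thesis
    by (simp only: norm_exp_i_times)
qed

lemma A_Omega_altdef:
  assumes "j \<ge> 1"
  shows "A_Omega k j = (1/2) *\<^sub>C (Omega j (k+1) + Omega (j + 2^k) (k+1))
     + (omega j (k+1) / 2) *\<^sub>C (Omega (3*j-1) (k+1) - Omega (3*j-1 + 2^k) (k+1))"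
proof -
  have "2 ^ k + 3 * j - 1 = 3 * j - 1 + 2 ^ k"
    using assms by simp
  then show ?thesis
    by (simp add: A_Omega_def scaleC_add_right complex_vector.scale_right_diff_distrib add_ac
        algebra_simps)
qed

lemma A_Omega_in_V: "A_Omega k j \<in> V (Suc k)"
  using Omega_in_V[of _ "Suc k"] by (auto simp: A_Omega_def intro!: V_add V_diff V_scaleC)

text \<open>
  Write \<open>P m\<close> and \<open>Q m\<close> for the sum and the difference of the basis vectors with indices \<open>m\<close> and
  \<open>m + N\<close>, where \<open>N = 2 ^ k\<close> is half the period on level \<open>k + 1\<close>. Then
  \<open>A_Omega k j\<close> is half of \<open>P j\<close> plus a unimodular multiple of half of \<open>Q (3 * j - 1)\<close>. All
  inner products reduce to the question which indices agree modulo \<open>2 * N\<close>. Both for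
  \<open>m = i\<close>, \<open>n = j\<close> and for \<open>m = 3 * i - 1\<close>, \<open>n = 3 * j - 1\<close>, the difference \<open>m - n\<close> is \<open>i - j\<close>
  times a factor coprime to \<open>N\<close>, and since \<open>\<bar>i - j\<bar> < N\<close>, it is divisible by \<open>N\<close> only for \<open>i = j\<close>.
  Hence \<open>m\<close> and \<open>n\<close> agree modulo \<open>2 * N\<close> only for \<open>i = j\<close>, and \<open>m\<close> and \<open>n + N\<close> never do.
\<close>

lemma A_Omega_orthonormal:
  assumes "i \<in> {1..2 ^ k}" "j \<in> {1..2 ^ k}"
  shows "V_inner (Suc k) (A_Omega k i) (A_Omega k j) = (if i = j then 1 else 0)"
proof -
  define N :: nat where "N = 2 ^ k"
  define d :: "nat \<Rightarrow> nat \<Rightarrow> complex" where "d m n = (if m mod (2 * N) = n mod (2 * N) then 1 else 0)" for m n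
  define P where "P m = Omega m (Suc k) + Omega (m + N) (Suc k)" for m
  define Q where "Q m = Omega m (Suc k) - Omega (m + N) (Suc k)" for m
  have [simp]: "P m \<in> V (Suc k)" "Q m \<in> V (Suc k)" for m
    by (auto simp: P_def Q_def Omega_in_V V_add V_diff)
  have inn: "V_inner (Suc k) (Omega m (Suc k)) (Omega n (Suc k)) = d m n" for m n
    by (simp add: V_inner_Omega_mod d_def N_def)
  have d_iff: "d m n = (if 2 * int N dvd int m - int n then 1 else 0)" for m n
  proof -
    have "m mod (2 * N) = n mod (2 * N) \<longleftrightarrow> int m mod int (2 * N) = int n mod int (2 * N)"
      by (simp only: zmod_int[symmetric] of_nat_eq_iff)
    then show ?thesis
      by (simp add: d_def mod_eq_dvd_iff)
  qed
  \<comment> \<open>\<open>N\<close> is half the period, so adding \<open>N\<close> on one side is the same as adding it on the other.\<close>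
  have d_shift2: "d (m + N) (n + N) = d m n" for m n
    by (simp add: d_iff)
  have d_shift: "d (m + N) n = d m (n + N)" "d m (n + N + N) = d m n" for m n
  proof -
    have double: "(l + N + N) mod (2 * N) = l mod (2 * N)" for l
      by (metis add.assoc mod_add_self2 mult_2)
    show "d (m + N) n = d m (n + N)"
      using d_shift2[of "m + N" n] by (simp only: d_def double)
    show "d m (n + N + N) = d m n"
      by (simp only: d_def double)
  qed
  have PP: "V_inner (Suc k) (P m) (P n) = 2 * (d m n + d m (n + N))"
    and PQ: "V_inner (Suc k) (P m) (Q n) = 0"
    and QP: "V_inner (Suc k) (Q m) (P n) = 0"
    and QQ: "V_inner (Suc k) (Q m) (Q n) = 2 * (d m n - d m (n + N))" for m n
    by (simp_all add: P_def Q_def V_inner_add_left V_inner_add_right V_inner_diff_left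
        V_inner_diff_right Omega_in_V V_add V_diff inn d_shift d_shift2)
  have ij: "1 \<le> i" "i \<le> N" "1 \<le> j" "j \<le> N"
    using assms by (auto simp: N_def)
  have small: "\<bar>int i - int j\<bar> < int N"
    using ij by linarith
  have not_N: "\<not> 2 * int N dvd int N"
    using ij by (auto dest: zdvd_imp_le)
  \<comment> \<open>Used with \<open>c = 1\<close> for the sums and with \<open>c = 3\<close> for the differences.\<close>
  have d_eq: "d m n = (if i = j then 1 else 0) \<and> d m (n + N) = 0"
    if mn: "int m - int n = (int i - int j) * c" and c: "coprime (int N) c" for m n c
  proof -
    have eq: "i = j" if "int N dvd int m - int n"
    proof -
      have "int N dvd int i - int j"
        using that c unfolding mn by (simp only: coprime_dvd_mult_left_iff)
      then have "int i - int j = 0"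
        using small dvd_imp_le_int[of "int i - int j" "int N"] by linarith
      then show ?thesis
        by simp
    qed
    have mN: "int m - int (n + N) = (int m - int n) - int N"
      by simp
    have "\<not> 2 * int N dvd int m - int (n + N)"
    proof
      assume *: "2 * int N dvd int m - int (n + N)"
      then have "int N dvd (int m - int n) - int N"
        unfolding mN by (rule dvd_mult_right)
      then have "int N dvd (int m - int n) - int N + int N"
        by (rule dvd_add) (rule dvd_refl)
      then have "i = j"
        by (intro eq) (simp only: diff_add_cancel)
      then have "int m - int n = 0"
        unfolding mn by (simp only: diff_self mult_zero_left)
      then have "2 * int N dvd - int N"
        using * unfolding mN by (simp only: diff_0)
      then show False
        using not_N unfolding dvd_minus_iff by contradiction
    qed
    moreover have "2 * int N dvd int m - int n \<longleftrightarrow> i = j"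
    proof
      show "i = j" if "2 * int N dvd int m - int n"
        using that by (intro eq) (rule dvd_mult_right)
      show "2 * int N dvd int m - int n" if "i = j"
        unfolding mn that by (simp only: diff_self mult_zero_left dvd_0_right)
    qed
    ultimately show ?thesis
      by (simp only: d_iff) (simp only: if_False simp_thms)
  qed
  have d1: "d i j = (if i = j then 1 else 0)" "d i (j + N) = 0"
    using d_eq[of i j 1] by (auto simp only: coprime_1_right mult_1_right)
  have "int (3 * i - 1) - int (3 * j - 1) = (int i - int j) * 3"
    using ij by (simp add: of_nat_diff)
  moreover have "coprime (int N) 3"
    by (simp add: N_def)
  ultimately have d2: "d (3 * i - 1) (3 * j - 1) = (if i = j then 1 else 0)"
       "d (3 * i - 1) (3 * j - 1 + N) = 0"
    using d_eq by blast+
  define a b where "a = 3 * i - 1" and "b = 3 * j - 1"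
  note d2 = d2[folded a_def b_def]
  have AO: "A_Omega k l = (1/2) *\<^sub>C P l + (omega l (Suc k) / 2) *\<^sub>C Q (3 * l - 1)" if "1 \<le> l" for l
    using A_Omega_altdef[OF that, of k] by (simp add: P_def Q_def N_def)
  have "V_inner (Suc k) (A_Omega k i) (A_Omega k j)
    = (d i j + d i (j + N)) / 2 + omega i (Suc k) * cnj (omega j (Suc k)) / 2 * (d a b - d a (b + N))"
    unfolding AO[OF ij(1)] AO[OF ij(3)] a_def[symmetric] b_def[symmetric]
    by (simp add: V_inner_add_left V_inner_add_right V_inner_scaleC_left
        V_inner_scaleC_right V_add V_scaleC PP PQ QP QQ) (simp add: field_simps)
  also have "\<dots> = (if i = j then 1 else 0)"
    using complex_norm_square[of "omega j (Suc k)"] by (simp add: d1 d2 cmod_omega)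
  finally show ?thesis .
qed

lemma A_in_V: "A k f \<in> V (Suc k)"
  by (simp add: A_def V_sum V_scaleC A_Omega_in_V)

lemma A_isometric: "V_inner (Suc k) (A k f) (A k g) = V_inner k f g"
proof -
  have "V_inner (Suc k) (A k f) (A k g) = (\<Sum>i = 1..2 ^ k. coord k f i *
      (\<Sum>j = 1..2 ^ k. cnj (coord k g j) * V_inner (Suc k) (A_Omega k i) (A_Omega k j)))"
    unfolding A_def by (subst V_inner_sum_left) (simp_all add: V_inner_sum_right A_Omega_in_V)
  also have "\<dots> = (\<Sum>i = 1..2 ^ k. coord k f i * (\<Sum>j = 1..2 ^ k. if j = i then cnj (coord k g i) else 0))"
    by (intro sum.cong refl arg_cong2[where f = times]) (auto simp: A_Omega_orthonormal)
  also have "\<dots> = V_inner k f g"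
    by (simp add: V_inner_def)
  finally show ?thesis .
qed

lemma A_zero [simp]: "A k 0 = 0"
  by (simp add: A_def)

lemma A_sum:
  assumes "\<And>i. i \<in> I \<Longrightarrow> h i \<in> V k"
  shows "A k (sum h I) = (\<Sum>i\<in>I. A k (h i))"
  using assms by (induction I rule: infinite_finite_induct) (auto simp: A_add V_sum)

section \<open>Square-summable families\<close>

text \<open>
  Tonelli's theorem for sums: for nonnegative terms, summability in one order of summation carries
  over to the other. It converts a square-summable family of vectors in \<open>V_inf\<close> into a vector whose
  levels are square-summable, and back.
\<close>

lemma nonneg_fubini:
  fixes f :: "'a \<Rightarrow> 'b \<Rightarrow> real"
  assumes nonneg: "\<And>a b. a \<in> I \<Longrightarrow> b \<in> J \<Longrightarrow> 0 \<le> f a b"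
    and row: "\<And>a. a \<in> I \<Longrightarrow> f a summable_on J"
    and rows: "(\<lambda>a. \<Sum>\<^sub>\<infinity>b\<in>J. f a b) summable_on I"
  shows "(\<lambda>b. \<Sum>\<^sub>\<infinity>a\<in>I. f a b) summable_on J"
    and "(\<Sum>\<^sub>\<infinity>b\<in>J. \<Sum>\<^sub>\<infinity>a\<in>I. f a b) = (\<Sum>\<^sub>\<infinity>a\<in>I. \<Sum>\<^sub>\<infinity>b\<in>J. f a b)"
proof -
  have IJ: "(\<lambda>(a, b). f a b) summable_on I \<times> J"
    by (rule summable_on_SigmaI[where g = "\<lambda>a. \<Sum>\<^sub>\<infinity>b\<in>J. f a b"]) (use assms in auto)
  then have JI: "(\<lambda>(b, a). f a b) summable_on J \<times> I"
    by (subst summable_on_swap) (simp add: case_prod_unfold)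
  show "(\<lambda>b. \<Sum>\<^sub>\<infinity>a\<in>I. f a b) summable_on J"
    using summable_on_Sigma_banach[of "\<lambda>b a. f a b" J "\<lambda>_. I"] JI by simp
  show "(\<Sum>\<^sub>\<infinity>b\<in>J. \<Sum>\<^sub>\<infinity>a\<in>I. f a b) = (\<Sum>\<^sub>\<infinity>a\<in>I. \<Sum>\<^sub>\<infinity>b\<in>J. f a b)"
    using infsum_swap_banach[OF IJ] by simp
qed

lemma infsum_off_finite:
  fixes f :: "'a \<Rightarrow> real"
  assumes "f summable_on I" "finite F" "F \<subseteq> I"
  shows "(\<lambda>i. if i \<in> F then 0 else f i) summable_on I"
    and "(\<Sum>\<^sub>\<infinity>i\<in>I. if i \<in> F then 0 else f i) = infsum f I - sum f F"
proof -
  have "(f has_sum infsum f I) I" "(f has_sum sum f F) F"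
    using assms by (auto intro: has_sum_finite)
  then have "(f has_sum infsum f I - sum f F) (I - F)"
    using assms(3) by (rule has_sum_Diff)
  then have "((\<lambda>i. if i \<in> F then 0 else f i) has_sum infsum f I - sum f F) I"
    by (subst has_sum_cong_neutral[where T = "I - F" and g = f]) auto
  then show "(\<lambda>i. if i \<in> F then 0 else f i) summable_on I"
    "(\<Sum>\<^sub>\<infinity>i\<in>I. if i \<in> F then 0 else f i) = infsum f I - sum f F"
    by (auto simp: infsumI summable_on_def)
qed

text \<open>
  Orbits that start on level \<open>k\<close> have coefficient sequences delayed by \<open>k\<close> places; the shift on \<open>ell2\<close>
  is the case \<open>k = 1\<close>.
\<close>

lemma has_sum_delay:
  fixes f :: "nat \<Rightarrow> real"
  shows "((\<lambda>n. if k \<le> n then f (n - k) else 0) has_sum s) UNIV \<longleftrightarrow> (f has_sum s) UNIV"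
    (is "(?g has_sum s) UNIV \<longleftrightarrow> _")
proof -
  have "(?g has_sum s) UNIV \<longleftrightarrow> (?g has_sum s) (range ((+) k))"
    by (rule has_sum_cong_neutral) (auto simp: image_iff, metis le_add_diff_inverse)
  also have "\<dots> \<longleftrightarrow> (?g \<circ> (+) k has_sum s) UNIV"
    by (rule has_sum_reindex) simp
  also have "?g \<circ> (+) k = f"
    by auto
  finally show ?thesis .
qed

text \<open>
  \<open>ip_norm\<close> takes the real part of the inner product, so the inner product of a vector with itself
  has to be known to be real before squared norms can be added up.
\<close>

lemma hsum_inner_self:
  assumes "u \<in> hsum I W p"
    and self: "\<And>i. i \<in> I \<Longrightarrow> p i (u i) (u i) = of_real ((ip_norm (p i) (u i))\<^sup>2)"
  shows "hsum_inner I p u u = of_real (\<Sum>\<^sub>\<infinity>i\<in>I. (ip_norm (p i) (u i))\<^sup>2)"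
    and "(ip_norm (hsum_inner I p) u)\<^sup>2 = (\<Sum>\<^sub>\<infinity>i\<in>I. (ip_norm (p i) (u i))\<^sup>2)"
    and "0 \<le> ip_norm (hsum_inner I p) u"
proof -
  have "((\<lambda>i. (ip_norm (p i) (u i))\<^sup>2) has_sum (\<Sum>\<^sub>\<infinity>i\<in>I. (ip_norm (p i) (u i))\<^sup>2)) I"
    using assms(1) by (simp add: hsum_def)
  from has_sum_of_real[OF this, where 'a = complex]
  have "((\<lambda>i. p i (u i) (u i)) has_sum of_real (\<Sum>\<^sub>\<infinity>i\<in>I. (ip_norm (p i) (u i))\<^sup>2)) I"
    using self by (subst has_sum_cong[where g = "\<lambda>i. of_real ((ip_norm (p i) (u i))\<^sup>2)"]) auto
  then show *: "hsum_inner I p u u = of_real (\<Sum>\<^sub>\<infinity>i\<in>I. (ip_norm (p i) (u i))\<^sup>2)"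
    by (simp add: hsum_inner_def infsumI)
  show "(ip_norm (hsum_inner I p) u)\<^sup>2 = (\<Sum>\<^sub>\<infinity>i\<in>I. (ip_norm (p i) (u i))\<^sup>2)"
    unfolding ip_norm_def[of "hsum_inner I p"] * by (simp add: infsum_nonneg)
  show "0 \<le> ip_norm (hsum_inner I p) u"
    unfolding ip_norm_def[of "hsum_inner I p"] * by (simp add: infsum_nonneg)
qed

lemma csubspace_hsum:
  fixes W :: "'i \<Rightarrow> 'a::complex_vector set"
  assumes W: "\<And>i. i \<in> I \<Longrightarrow> csubspace (W i)"
    and zero: "\<And>i. i \<in> I \<Longrightarrow> ip_norm (p i) 0 = 0"
    and add: "\<And>i x y. i \<in> I \<Longrightarrow> x \<in> W i \<Longrightarrow> y \<in> W i \<Longrightarrow>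
      (ip_norm (p i) (x + y))\<^sup>2 \<le> 2 * ((ip_norm (p i) x)\<^sup>2 + (ip_norm (p i) y)\<^sup>2)"
    and scale: "\<And>i x c. i \<in> I \<Longrightarrow> x \<in> W i \<Longrightarrow> ip_norm (p i) (c *\<^sub>C x) = cmod c * ip_norm (p i) x"
  shows "csubspace (hsum I W p)"
proof (rule complex_vector.subspaceI)
  show "0 \<in> hsum I W p"
    using W zero by (auto simp: hsum_def complex_vector.subspace_0 cong: summable_on_cong)
next
  fix u v
  assume u: "u \<in> hsum I W p" and v: "v \<in> hsum I W p"
  then have "(\<lambda>i. 2 * ((ip_norm (p i) (u i))\<^sup>2 + (ip_norm (p i) (v i))\<^sup>2)) summable_on I"
    by (auto simp: hsum_def intro!: summable_on_cmult_right summable_on_add)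
  then have "(\<lambda>i. (ip_norm (p i) (u i + v i))\<^sup>2) summable_on I"
    by (rule summable_on_comparison_test) (use u v in \<open>auto simp: hsum_def simp del: distrib_left_numeral intro!: add\<close>)
  then show "u + v \<in> hsum I W p"
    using u v W by (auto simp: hsum_def complex_vector.subspace_add)
next
  fix c u
  assume u: "u \<in> hsum I W p"
  then have "(\<lambda>i. (cmod c)\<^sup>2 * (ip_norm (p i) (u i))\<^sup>2) summable_on I"
    by (auto simp: hsum_def intro!: summable_on_cmult_right)
  then have "(\<lambda>i. (ip_norm (p i) (c *\<^sub>C u i))\<^sup>2) summable_on I"
    using u by (subst summable_on_cong[where g = "\<lambda>i. (cmod c)\<^sup>2 * (ip_norm (p i) (u i))\<^sup>2"])
      (auto simp: hsum_def scale power_mult_distrib)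
  then show "c *\<^sub>C u \<in> hsum I W p"
    using u W by (auto simp: hsum_def scaleC_fun_def complex_vector.subspace_scale)
qed

lemma isometric_iso_inverse:
  assumes "isometric_iso X p Y q T" "csubspace X"
  shows "isometric_iso Y q X p (the_inv_into X T)"
proof -
  let ?R = "the_inv_into X T"
  have bij: "bij_betw T X Y" and inj: "inj_on T X"
    using assms by (auto simp: isometric_iso_def bij_betw_def)
  have R: "?R y \<in> X" "T (?R y) = y" if "y \<in> Y" for y
    using bij that by (auto simp: bij_betw_def f_the_inv_into_f intro: the_inv_into_into)
  have R_eq: "?R y = x" if "x \<in> X" "T x = y" for x y
    using inj that by (auto simp: the_inv_into_f_f)
  show ?thesis
    unfolding isometric_iso_def
  proof (intro conjI ballI allI)
    show "bij_betw ?R Y X"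
      using bij by (rule bij_betw_the_inv_into)
    show "?R (x + y) = ?R x + ?R y" if "x \<in> Y" "y \<in> Y" for x y
      using assms R[OF that(1)] R[OF that(2)]
      by (intro R_eq) (auto simp: isometric_iso_def complex_vector.subspace_add)
    show "?R (c *\<^sub>C x) = c *\<^sub>C ?R x" if "x \<in> Y" for c x
      using assms R[OF that]
      by (intro R_eq) (auto simp: isometric_iso_def complex_vector.subspace_scale)
    show "ip_norm p (?R x) = ip_norm q x" if "x \<in> Y" for x
      using assms R[OF that] by (metis isometric_iso_def)
  qed
qed

lemma cmod_ip_norm: "ip_norm (\<lambda>a b. a * cnj b) a = cmod a"
  by (simp add: ip_norm_def flip: complex_norm_square)

lemma ell2_iff: "a \<in> ell2 \<longleftrightarrow> (\<lambda>n. (cmod (a n))\<^sup>2) summable_on UNIV"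
  by (simp add: ell2_def hsum_def cmod_ip_norm)

lemma ell2_norm_sq: "a \<in> ell2 \<Longrightarrow> (ip_norm ell2_inner a)\<^sup>2 = (\<Sum>\<^sub>\<infinity>n. (cmod (a n))\<^sup>2)"
  and ell2_norm_nonneg: "a \<in> ell2 \<Longrightarrow> 0 \<le> ip_norm ell2_inner a"
  using hsum_inner_self(2,3)[of a UNIV "\<lambda>_. UNIV" "\<lambda>_ a b. a * cnj b"]
  by (simp_all add: ell2_def ell2_inner_def cmod_ip_norm complex_norm_square del: of_real_power)

lemma csubspace_ell2: "csubspace ell2"
  unfolding ell2_def
  by (rule csubspace_hsum)
     (auto simp: cmod_ip_norm cmod_add_sq_le scaleC_complex_def norm_mult
       simp del: distrib_left_numeral intro!: complex_vector.subspaceI)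

lemma ell2_finite_support:
  assumes "finite F"
  shows "(\<Sum>i\<in>F. c i *\<^sub>C ell2_unit i) = (\<lambda>i. if i \<in> F then c i else 0)"
  using assms by (auto simp: sum_fun_apply scaleC_fun_def scaleC_complex_def ell2_unit_def fun_eq_iff
      if_distrib cong: if_cong)

lemma ell2_unit_in_ell2: "ell2_unit i \<in> ell2"
  unfolding ell2_iff
  by (rule finite_nonzero_values_imp_summable_on) (simp add: ell2_unit_def)

lemma ell2_shift:
  assumes "a \<in> ell2"
  shows ell2_shift_in_ell2: "ell2_shift a \<in> ell2"
    and ell2_shift_isometric: "ip_norm ell2_inner (ell2_shift a) = ip_norm ell2_inner a"
proof -
  have "(\<lambda>n. (cmod (ell2_shift a n))\<^sup>2) = (\<lambda>n. if 1 \<le> n then (cmod (a (n - 1)))\<^sup>2 else 0)"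
    by (auto simp: ell2_shift_def fun_eq_iff split: nat.split)
  then have "((\<lambda>n. (cmod (ell2_shift a n))\<^sup>2) has_sum (ip_norm ell2_inner a)\<^sup>2) UNIV"
    using assms has_sum_delay[of 1 "\<lambda>n. (cmod (a n))\<^sup>2"]
    by (simp only: ell2_norm_sq) (simp add: ell2_iff)
  then have "ell2_shift a \<in> ell2" "(ip_norm ell2_inner (ell2_shift a))\<^sup>2 = (ip_norm ell2_inner a)\<^sup>2"
    using ell2_norm_sq[of "ell2_shift a"] by (auto simp: ell2_iff summable_on_def infsumI)
  then show "ell2_shift a \<in> ell2" "ip_norm ell2_inner (ell2_shift a) = ip_norm ell2_inner a"
    using assms by (auto simp: power2_eq_iff_nonneg ell2_norm_nonneg)
qed

section \<open>The space \<open>V_inf\<close>\<close>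

lemma V_inf_iff:
  "x \<in> V_inf \<longleftrightarrow> (\<forall>n. x n \<in> V n) \<and> (\<lambda>n. (ip_norm (V_inner n) (x n))\<^sup>2) summable_on UNIV"
  by (simp add: V_inf_def hsum_def)

lemma V_inf_in_V: "x \<in> V_inf \<Longrightarrow> x n \<in> V n"
  by (simp add: V_inf_iff)

lemma csubspace_V_inf: "csubspace V_inf"
  unfolding V_inf_def
  by (rule csubspace_hsum) (simp_all add: csubspace_V V_norm_add_sq_le V_norm_scaleC del: distrib_left_numeral)

lemma
  assumes "x \<in> V_inf"
  shows V_inf_inner_self: "V_inf_inner x x = of_real ((ip_norm V_inf_inner x)\<^sup>2)"
    and V_inf_norm_sq: "(ip_norm V_inf_inner x)\<^sup>2 = (\<Sum>\<^sub>\<infinity>n. (ip_norm (V_inner n) (x n))\<^sup>2)"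
    and V_inf_norm_nonneg: "0 \<le> ip_norm V_inf_inner x"
  using hsum_inner_self[of x UNIV V V_inner] assms
  by (simp_all add: V_inf_def V_inf_inner_def V_inner_self del: of_real_power)

lemma V_norm_le_V_inf_norm:
  assumes "x \<in> V_inf"
  shows "ip_norm (V_inner n) (x n) \<le> ip_norm V_inf_inner x"
proof (rule power2_le_imp_le)
  have "(\<Sum>n\<in>{n}. (ip_norm (V_inner n) (x n))\<^sup>2) \<le> (\<Sum>\<^sub>\<infinity>n. (ip_norm (V_inner n) (x n))\<^sup>2)"
    using assms by (intro finite_sum_le_infsum) (auto simp: V_inf_iff)
  then show "(ip_norm (V_inner n) (x n))\<^sup>2 \<le> (ip_norm V_inf_inner x)\<^sup>2"
    using V_inf_norm_sq[OF assms] by simp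
qed (rule V_inf_norm_nonneg[OF assms])

lemma V_inf_norm_sq_uminus:
  assumes "x \<in> V_inf"
  shows "(ip_norm V_inf_inner (- x))\<^sup>2 = (ip_norm V_inf_inner x)\<^sup>2"
proof -
  have "ip_norm (V_inner n) (- x n) = ip_norm (V_inner n) (x n)" for n
    using V_norm_scaleC[OF V_inf_in_V[OF assms], of n "- 1"]
    by (simp add: complex_vector.scale_minus_left scaleC_one)
  moreover have "- x \<in> V_inf"
    using csubspace_V_inf assms by (rule complex_vector.subspace_neg)
  ultimately show ?thesis
    using assms by (simp add: V_inf_norm_sq)
qed

section \<open>Orbit spaces of a basis adapted to the shift\<close>

text \<open>
  All that the decomposition uses about the vectors \<open>S\<^sup>i e\<^sub>j\<^sub>k\<close> is collected here: an index \<open>q\<close> is born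
  on level \<open>deg q\<close>, on each later level it contributes one basis vector \<open>b q n\<close>, and \<open>A n\<close> maps each
  basis vector of level \<open>n\<close> to the one with the same index on the next level.
\<close>

locale shift_basis =
  fixes I :: "'q set" and deg :: "'q \<Rightarrow> nat" and b :: "'q \<Rightarrow> nat \<Rightarrow> nat \<Rightarrow> complex"
  assumes finite_deg: "finite {q \<in> I. deg q \<le> n}"
    and basis: "orthonormal_basis (V_inner n) {q \<in> I. deg q \<le> n} (\<lambda>q. b q n) (V n)"
    and b_Suc: "q \<in> I \<Longrightarrow> deg q \<le> n \<Longrightarrow> b q (Suc n) = A n (b q n)"
begin

definition level_index :: "nat \<Rightarrow> 'q set"
  where "level_index n = {q \<in> I. deg q \<le> n}"

lemma level_index_iff: "q \<in> I \<Longrightarrow> q \<in> level_index n \<longleftrightarrow> deg q \<le> n"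
  by (simp add: level_index_def)

lemma finite_level_index: "finite (level_index n)"
  unfolding level_index_def by (rule finite_deg)

lemma onb: "orthonormal_basis (V_inner n) (level_index n) (\<lambda>q. b q n) (V n)"
  unfolding level_index_def by (rule basis)

lemmas b_mem = onb_mem[OF finite_level_index onb]
lemmas b_inner = onb_inner[OF finite_level_index onb]
lemmas b_expansion = onb_expansion[OF finite_level_index onb]
lemmas b_norm_sum = onb_norm_sum[OF finite_level_index onb]
lemmas b_parseval = onb_parseval[OF finite_level_index onb]
lemmas b_coefficient_le = onb_coefficient_le[OF finite_level_index onb]

lemma b_norm: "q \<in> level_index n \<Longrightarrow> ip_norm (V_inner n) (c *\<^sub>C b q n) = cmod c"
  by (simp add: V_norm_scaleC b_mem) (simp add: ip_norm_def b_inner)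

text \<open>
  This is the series of the vectors \<open>a i *\<^sub>C (S ^^ i) e\<close>, where \<open>e\<close> is the starting vector \<open>b q (deg q)\<close> of the
  orbit, placed on level \<open>deg q\<close>. Its \<open>i\<close>-th term lives on level \<open>deg q + i\<close>, so each level contains at
  most one term.
\<close>

definition orbit_sum :: "'q \<Rightarrow> (nat \<Rightarrow> complex) \<Rightarrow> nat \<Rightarrow> nat \<Rightarrow> complex"
  where "orbit_sum q a = (\<lambda>n. if deg q \<le> n then a (n - deg q) *\<^sub>C b q n else 0)"

text \<open>
  The orthogonal complement of all other orbits. Described by vanishing coefficients, it is visibly
  closed; that it is the closed span of the orbit of \<open>q\<close> is \<open>closed_span_orbit\<close>.
\<close>

definition orbit_space :: "'q \<Rightarrow> (nat \<Rightarrow> nat \<Rightarrow> complex) set"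
  where "orbit_space q =
    {x \<in> V_inf. \<forall>n. \<forall>r\<in>level_index n. r \<noteq> q \<longrightarrow> V_inner n (x n) (b r n) = 0}"

lemma orbit_sum_zero: "orbit_sum q 0 = 0"
  and orbit_sum_add: "orbit_sum q (u + v) = orbit_sum q u + orbit_sum q v"
  and orbit_sum_scaleC: "orbit_sum q (c *\<^sub>C u) = c *\<^sub>C orbit_sum q u"
  by (auto simp: orbit_sum_def fun_eq_iff scaleC_add_left scaleC_fun_def scaleC_complex_def
      algebra_simps)

lemma orbit_sum_norm:
  assumes "q \<in> I"
  shows "(ip_norm (V_inner n) (orbit_sum q a n))\<^sup>2
    = (if deg q \<le> n then (cmod (a (n - deg q)))\<^sup>2 else 0)"
  using assms by (simp add: orbit_sum_def b_norm level_index_iff)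

lemma orbit_sum_norm_has_sum:
  assumes "q \<in> I"
  shows "((\<lambda>n. (ip_norm (V_inner n) (orbit_sum q a n))\<^sup>2) has_sum s) UNIV
    \<longleftrightarrow> ((\<lambda>i. (cmod (a i))\<^sup>2) has_sum s) UNIV"
  unfolding orbit_sum_norm[OF assms] by (rule has_sum_delay)

lemma orbit_sum_in_V_inf:
  assumes "q \<in> I"
  shows "orbit_sum q a \<in> V_inf \<longleftrightarrow> a \<in> ell2"
proof -
  have "orbit_sum q a n \<in> V n" for n
    using assms by (simp add: orbit_sum_def b_mem V_scaleC level_index_iff)
  then show ?thesis
    using orbit_sum_norm_has_sum[OF assms, of a] by (simp add: V_inf_iff ell2_iff summable_on_def)
qed

lemma orbit_sum_isometric:
  assumes "q \<in> I" "a \<in> ell2"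
  shows "ip_norm V_inf_inner (orbit_sum q a) = ip_norm ell2_inner a"
proof -
  have "((\<lambda>i. (cmod (a i))\<^sup>2) has_sum (ip_norm ell2_inner a)\<^sup>2) UNIV"
    using assms(2) by (simp add: ell2_norm_sq ell2_iff)
  then have "(ip_norm V_inf_inner (orbit_sum q a))\<^sup>2 = (ip_norm ell2_inner a)\<^sup>2"
    using orbit_sum_norm_has_sum[OF assms(1)] orbit_sum_in_V_inf[OF assms(1)] assms(2)
    by (simp add: V_inf_norm_sq infsumI)
  then show ?thesis
    by (rule power2_eq_imp_eq)
       (use assms in \<open>auto simp: V_inf_norm_nonneg orbit_sum_in_V_inf ell2_norm_nonneg\<close>)
qed

lemma orbit_sum_coefficient:
  assumes "q \<in> I" "r \<in> level_index n"
  shows "V_inner n (orbit_sum q a n) (b r n) = (if r = q then a (n - deg q) else 0)"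
  using assms
  by (auto simp: orbit_sum_def level_index_iff V_inner_scaleC_left b_mem b_inner)

lemma orbit_space_level:
  assumes "x \<in> orbit_space q" "q \<in> I"
  shows "x n = (if deg q \<le> n then V_inner n (x n) (b q n) *\<^sub>C b q n else 0)"
proof -
  have "x n = (\<Sum>r\<in>level_index n. V_inner n (x n) (b r n) *\<^sub>C b r n)"
    using assms(1) by (intro b_expansion) (auto simp: orbit_space_def V_inf_iff)
  also have "\<dots> = (\<Sum>r\<in>level_index n. if r = q then V_inner n (x n) (b q n) *\<^sub>C b q n else 0)"
    using assms(1) by (intro sum.cong) (auto simp: orbit_space_def)
  also have "\<dots> = (if deg q \<le> n then V_inner n (x n) (b q n) *\<^sub>C b q n else 0)"
    using finite_level_index assms(2) by (simp add: level_index_iff)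
  finally show ?thesis .
qed

lemma orbit_sum_isometric_iso:
  assumes "q \<in> I"
  shows "isometric_iso ell2 ell2_inner (orbit_space q) V_inf_inner (orbit_sum q)"
  unfolding isometric_iso_def
proof (intro conjI ballI allI)
  show "bij_betw (orbit_sum q) ell2 (orbit_space q)"
  proof (rule bij_betwI[where g = "\<lambda>x i. V_inner (deg q + i) (x (deg q + i)) (b q (deg q + i))"])
    show "orbit_sum q \<in> ell2 \<rightarrow> orbit_space q"
      using assms by (auto simp: orbit_space_def orbit_sum_in_V_inf orbit_sum_coefficient)
    have inverse: "orbit_sum q (\<lambda>i. V_inner (deg q + i) (x (deg q + i)) (b q (deg q + i))) = x"
      if "x \<in> orbit_space q" for x
      by (rule ext, subst (2) orbit_space_level[OF that assms]) (simp add: orbit_sum_def)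
    then show "orbit_sum q (\<lambda>i. V_inner (deg q + i) (x (deg q + i)) (b q (deg q + i))) = x"
      if "x \<in> orbit_space q" for x
      using that .
    show "(\<lambda>x i. V_inner (deg q + i) (x (deg q + i)) (b q (deg q + i))) \<in> orbit_space q \<rightarrow> ell2"
      using inverse assms
      by (auto simp: orbit_space_def simp flip: orbit_sum_in_V_inf)
    show "(\<lambda>i. V_inner (deg q + i) (orbit_sum q a (deg q + i)) (b q (deg q + i))) = a" for a
      using assms by (simp add: orbit_sum_coefficient level_index_iff)
  qed
qed (use assms in \<open>auto simp: orbit_sum_add orbit_sum_scaleC orbit_sum_isometric\<close>)

lemma S_orbit_sum:
  assumes "q \<in> I"
  shows "S (orbit_sum q a) = orbit_sum q (ell2_shift a)"
proof
  fix n
  show "S (orbit_sum q a) n = orbit_sum q (ell2_shift a) n"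
  proof (cases n)
    case 0
    then show ?thesis
      by (simp add: S_def orbit_sum_def ell2_shift_def)
  next
    case (Suc m)
    then show ?thesis
      using assms
      by (auto simp: S_def orbit_sum_def ell2_shift_def level_index_iff A_scaleC b_mem b_Suc
          Suc_diff_le le_Suc_eq)
  qed
qed

lemma S_funpow_orbit:
  assumes "q \<in> I"
  shows "(S ^^ i) (orbit_sum q (ell2_unit 0)) = orbit_sum q (ell2_unit i)"
proof (induction i)
  case (Suc i)
  have "ell2_shift (ell2_unit i) = ell2_unit (Suc i)"
    by (auto simp: ell2_shift_def ell2_unit_def fun_eq_iff split: nat.split)
  then show ?case
    using Suc assms by (simp add: S_orbit_sum)
qed simp

lemma csubspace_orbit_space: "csubspace (orbit_space q)"
proof (rule complex_vector.subspaceI)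
  show "0 \<in> orbit_space q"
    using csubspace_V_inf by (simp add: orbit_space_def complex_vector.subspace_0)
next
  fix x y
  assume xy: "x \<in> orbit_space q" "y \<in> orbit_space q"
  then have "x + y \<in> V_inf" "x n \<in> V n" "y n \<in> V n" for n
    using csubspace_V_inf
    by (auto simp: orbit_space_def intro: complex_vector.subspace_add V_inf_in_V)
  then show "x + y \<in> orbit_space q"
    using xy by (simp add: orbit_space_def V_inner_add_left)
next
  fix c x
  assume x: "x \<in> orbit_space q"
  then have "c *\<^sub>C x \<in> V_inf" "x n \<in> V n" for n
    using csubspace_V_inf
    by (auto simp: orbit_space_def intro: complex_vector.subspace_scale V_inf_in_V)
  then show "c *\<^sub>C x \<in> orbit_space q"
    using x by (simp add: orbit_space_def V_inner_scaleC_left scaleC_fun_def[of c x])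
qed

text \<open>
  Each coefficient is bounded by the norm, so a coefficient that vanishes on the orbit space vanishes
  on its closure.
\<close>

lemma norm_closure_orbit_space: "norm_closure V_inf V_inf_inner (orbit_space q) = orbit_space q"
proof
  show "norm_closure V_inf V_inf_inner (orbit_space q) \<subseteq> orbit_space q"
  proof
    fix x
    assume x: "x \<in> norm_closure V_inf V_inf_inner (orbit_space q)"
    then have xV: "x \<in> V_inf"
      by (simp add: norm_closure_def)
    have "V_inner n (x n) (b r n) = 0" if r: "r \<in> level_index n" "r \<noteq> q" for n r
    proof (rule ccontr)
      assume "V_inner n (x n) (b r n) \<noteq> 0"
      then obtain y where y: "y \<in> orbit_space q"
        and less: "ip_norm V_inf_inner (x - y) < cmod (V_inner n (x n) (b r n))"
        using x unfolding norm_closure_def by (auto dest: spec[of _ "cmod (V_inner n (x n) (b r n))"])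
      have yV: "y \<in> V_inf" and y0: "V_inner n (y n) (b r n) = 0"
        using y r by (auto simp: orbit_space_def)
      have xy: "x - y \<in> V_inf"
        using csubspace_V_inf xV yV by (rule complex_vector.subspace_diff)
      have "cmod (V_inner n (x n) (b r n)) = cmod (V_inner n ((x - y) n) (b r n))"
        using xV yV y0 by (simp add: V_inner_diff_left V_inf_iff)
      also have "\<dots> \<le> ip_norm (V_inner n) ((x - y) n)"
        using xy r(1) by (intro b_coefficient_le) (auto simp: V_inf_iff)
      also have "\<dots> \<le> ip_norm V_inf_inner (x - y)"
        by (rule V_norm_le_V_inf_norm[OF xy])
      finally show False
        using less by simp
    qed
    then show "x \<in> orbit_space q"
      using xV by (simp add: orbit_space_def)
  qed
  show "orbit_space q \<subseteq> norm_closure V_inf V_inf_inner (orbit_space q)"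
  proof
    fix x
    assume x: "x \<in> orbit_space q"
    have "ip_norm V_inf_inner (x - x) = 0"
      using V_inf_norm_sq[of 0] csubspace_V_inf by (simp add: complex_vector.subspace_0)
    then show "x \<in> norm_closure V_inf V_inf_inner (orbit_space q)"
      using x by (auto simp: norm_closure_def orbit_space_def intro!: bexI[of _ x])
  qed
qed

lemma closed_subspace_orbit_space: "closed_subspace V_inf V_inf_inner (orbit_space q)"
  by (auto simp: closed_subspace_def csubspace_orbit_space norm_closure_orbit_space)
     (auto simp: orbit_space_def)

text \<open>
  The orbit space is a closed subspace containing the orbit, which gives one inclusion. For the other
  one, finite sections of the coefficient sequence approximate a vector, with a squared error equal
  to the tail of the series of squared moduli.
\<close>

lemma closed_span_orbit:
  assumes "q \<in> I"
  shows "closed_span (range (\<lambda>i. (S ^^ i) (orbit_sum q (ell2_unit 0)))) = orbit_space q"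
proof -
  let ?span = "cspan (range (\<lambda>i. orbit_sum q (ell2_unit i)))"
  have iso: "isometric_iso ell2 ell2_inner (orbit_space q) V_inf_inner (orbit_sum q)"
    by (rule orbit_sum_isometric_iso[OF assms])
  then have image: "orbit_space q = orbit_sum q ` ell2"
    by (simp add: isometric_iso_def bij_betw_def)
  have unit: "orbit_sum q (ell2_unit i) \<in> orbit_space q" for i
    by (simp add: image ell2_unit_in_ell2)
  have "?span \<subseteq> orbit_space q"
    by (rule complex_vector.span_minimal) (auto simp: unit csubspace_orbit_space)
  then have "norm_closure V_inf V_inf_inner ?span \<subseteq> norm_closure V_inf V_inf_inner (orbit_space q)"
    by (force simp: norm_closure_def)
  moreover have "orbit_space q \<subseteq> norm_closure V_inf V_inf_inner ?span"
  proof
    fix x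
    assume x: "x \<in> orbit_space q"
    then obtain a where a: "a \<in> ell2" "x = orbit_sum q a"
      by (auto simp: image)
    have "\<exists>y\<in>?span. ip_norm V_inf_inner (x - y) < \<epsilon>" if "\<epsilon> > 0" for \<epsilon>
    proof -
      let ?f = "\<lambda>i. (cmod (a i))\<^sup>2"
      have f: "?f summable_on UNIV"
        using a(1) by (simp add: ell2_iff)
      obtain F where F: "finite F" "dist (sum ?f F) (infsum ?f UNIV) \<le> \<epsilon>\<^sup>2 / 2"
        using infsum_finite_approximation[OF f, of "\<epsilon>\<^sup>2 / 2"] \<open>\<epsilon> > 0\<close> by auto
      define y where "y = (\<Sum>i\<in>F. a i *\<^sub>C orbit_sum q (ell2_unit i))"
      define t where "t = (\<lambda>i. if i \<in> F then 0 else a i)"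
      have "y = orbit_sum q (\<Sum>i\<in>F. a i *\<^sub>C ell2_unit i)"
        unfolding y_def using F(1)
        by (induction F rule: finite_induct)
          (simp_all only: sum.empty sum.insert not_False_eq_True orbit_sum_zero orbit_sum_add orbit_sum_scaleC)
      then have "x - y = orbit_sum q t"
        using a(2) F(1)
        by (auto simp: ell2_finite_support orbit_sum_def t_def fun_eq_iff)
      moreover have sq: "(\<lambda>i. (cmod (t i))\<^sup>2) = (\<lambda>i. if i \<in> F then 0 else ?f i)"
        by (auto simp: t_def)
      moreover have "t \<in> ell2"
        using infsum_off_finite(1)[OF f F(1)] by (simp add: ell2_iff sq)
      ultimately have "(ip_norm V_inf_inner (x - y))\<^sup>2 = infsum ?f UNIV - sum ?f F"
        using infsum_off_finite(2)[OF f F(1)]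
        by (simp add: orbit_sum_isometric[OF assms] ell2_norm_sq)
      also have "\<dots> \<le> \<epsilon>\<^sup>2 / 2"
        using F(2) unfolding dist_real_def by linarith
      also have "\<dots> < \<epsilon>\<^sup>2"
        using \<open>\<epsilon> > 0\<close> by simp
      finally have "ip_norm V_inf_inner (x - y) < \<epsilon>"
        using \<open>\<epsilon> > 0\<close> by (simp add: power_less_imp_less_base)
      moreover have "y \<in> ?span"
        unfolding y_def
        by (intro complex_vector.span_sum complex_vector.span_scale complex_vector.span_base) auto
      ultimately show ?thesis
        by blast
    qed
    then show "x \<in> norm_closure V_inf V_inf_inner ?span"
      using x by (simp add: norm_closure_def orbit_space_def)
  qed
  ultimately show ?thesis
    by (simp add: closed_span_def S_funpow_orbit[OF assms] norm_closure_orbit_space)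
qed

lemma S_orbit_space:
  assumes "q \<in> I" "x \<in> orbit_space q"
  shows "S x \<in> orbit_space q" and "ip_norm V_inf_inner (S x) = ip_norm V_inf_inner x"
proof -
  have image: "orbit_space q = orbit_sum q ` ell2"
    using orbit_sum_isometric_iso[OF assms(1)] by (simp add: isometric_iso_def bij_betw_def)
  then obtain a where "a \<in> ell2" "x = orbit_sum q a"
    using assms(2) by auto
  then show "S x \<in> orbit_space q" and "ip_norm V_inf_inner (S x) = ip_norm V_inf_inner x"
    using assms(1)
    by (simp_all add: image S_orbit_sum ell2_shift_in_ell2 orbit_sum_isometric ell2_shift_isometric)
qed

section \<open>Decomposition into orbit spaces\<close>

text \<open>
  The canonical map from the external Hilbert sum. Only finitely many orbits have reached level \<open>n\<close>, so
  the map can be defined by finite sums; that these give the norm-convergent sum of the family is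
  \<open>norm_has_sum_levelwise_sum\<close>.
\<close>

definition levelwise_sum :: "('q \<Rightarrow> nat \<Rightarrow> nat \<Rightarrow> complex) \<Rightarrow> nat \<Rightarrow> nat \<Rightarrow> complex"
  where "levelwise_sum u = (\<lambda>n. \<Sum>q\<in>level_index n. u q n)"

abbreviation orbit_hsum :: "('q \<Rightarrow> nat \<Rightarrow> nat \<Rightarrow> complex) set"
  where "orbit_hsum \<equiv> hsum I orbit_space (\<lambda>_. V_inf_inner)"

lemma orbit_space_subset: "orbit_space q \<subseteq> V_inf"
  by (auto simp: orbit_space_def)

lemma levelwise_sum_add: "levelwise_sum (u + v) = levelwise_sum u + levelwise_sum v"
  by (simp add: levelwise_sum_def fun_eq_iff sum.distrib sum_fun_apply)

lemma levelwise_sum_scaleC: "levelwise_sum (c *\<^sub>C u) = c *\<^sub>C levelwise_sum u"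
  by (simp add: levelwise_sum_def fun_eq_iff scaleC_fun_def scaleC_complex_def sum_fun_apply
      sum_distrib_left)

text \<open>
  Parseval's identity on one level. The sum runs over all of \<open>I\<close> rather than over \<open>level_index n\<close>, so
  that the order of summation over indices and levels can be exchanged afterwards.
\<close>

lemma levelwise_sum_level_norm:
  assumes "\<And>q. q \<in> I \<Longrightarrow> u q \<in> orbit_space q"
  shows "(ip_norm (V_inner n) (levelwise_sum u n))\<^sup>2
    = (\<Sum>\<^sub>\<infinity>q\<in>I. (ip_norm (V_inner n) (u q n))\<^sup>2)"
proof -
  let ?c = "\<lambda>q. V_inner n (u q n) (b q n)"
  have u: "u q n = (if deg q \<le> n then ?c q *\<^sub>C b q n else 0)" if "q \<in> I" for q
    using assms[OF that] that by (rule orbit_space_level)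
  have in_index: "q \<in> I \<and> deg q \<le> n" if "q \<in> level_index n" for q
    using that by (simp add: level_index_def)
  have on_level: "u q n = ?c q *\<^sub>C b q n" if "q \<in> level_index n" for q
    using u in_index[OF that] by metis
  have "levelwise_sum u n = (\<Sum>q\<in>level_index n. ?c q *\<^sub>C b q n)"
    unfolding levelwise_sum_def by (intro sum.cong refl) (rule on_level)
  then have "(ip_norm (V_inner n) (levelwise_sum u n))\<^sup>2 = (\<Sum>q\<in>level_index n. (cmod (?c q))\<^sup>2)"
    by (simp only: b_norm_sum)
  also have "\<dots> = (\<Sum>q\<in>level_index n. (ip_norm (V_inner n) (u q n))\<^sup>2)"
    by (intro sum.cong refl) (metis b_norm on_level)
  also have "\<dots> = (\<Sum>\<^sub>\<infinity>q\<in>level_index n. (ip_norm (V_inner n) (u q n))\<^sup>2)"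
    by (simp add: finite_level_index)
  also have "\<dots> = (\<Sum>\<^sub>\<infinity>q\<in>I. (ip_norm (V_inner n) (u q n))\<^sup>2)"
    by (rule infsum_cong_neutral) (auto simp: level_index_def, subst u, auto)
  finally show ?thesis .
qed

lemma orbit_hsum_norm:
  assumes "u \<in> orbit_hsum"
  shows "(ip_norm (hsum_inner I (\<lambda>_. V_inf_inner)) u)\<^sup>2
      = (\<Sum>\<^sub>\<infinity>q\<in>I. (ip_norm V_inf_inner (u q))\<^sup>2)"
    and "0 \<le> ip_norm (hsum_inner I (\<lambda>_. V_inf_inner)) u"
proof -
  have "V_inf_inner (u q) (u q) = of_real ((ip_norm V_inf_inner (u q))\<^sup>2)" if "q \<in> I" for q
    using assms orbit_space_subset that by (intro V_inf_inner_self) (auto simp: hsum_def)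
  note self = hsum_inner_self[OF assms this]
  show "(ip_norm (hsum_inner I (\<lambda>_. V_inf_inner)) u)\<^sup>2
      = (\<Sum>\<^sub>\<infinity>q\<in>I. (ip_norm V_inf_inner (u q))\<^sup>2)"
    by (rule self(2))
  show "0 \<le> ip_norm (hsum_inner I (\<lambda>_. V_inf_inner)) u"
    by (rule self(3))
qed

lemma levelwise_sum_isometric:
  assumes "u \<in> orbit_hsum"
  shows "levelwise_sum u \<in> V_inf"
    and "ip_norm V_inf_inner (levelwise_sum u) = ip_norm (hsum_inner I (\<lambda>_. V_inf_inner)) u"
proof -
  let ?f = "\<lambda>q n. (ip_norm (V_inner n) (u q n))\<^sup>2"
  have u: "u q \<in> orbit_space q" "u q \<in> V_inf" if "q \<in> I" for q
    using assms orbit_space_subset that by (auto simp: hsum_def)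
  have row: "?f q summable_on UNIV" if "q \<in> I" for q
    using u(2)[OF that] by (simp add: V_inf_iff)
  have rows: "(\<lambda>q. infsum (?f q) UNIV) summable_on I"
    using assms u(2)
    by (subst summable_on_cong[where g = "\<lambda>q. (ip_norm V_inf_inner (u q))\<^sup>2"])
       (auto simp: hsum_def V_inf_norm_sq)
  have level: "(ip_norm (V_inner n) (levelwise_sum u n))\<^sup>2 = (\<Sum>\<^sub>\<infinity>q\<in>I. ?f q n)" for n
    by (rule levelwise_sum_level_norm) (rule u(1))
  have "levelwise_sum u n \<in> V n" for n
    unfolding levelwise_sum_def using u(2)
    by (intro V_sum) (auto simp: level_index_def V_inf_in_V)
  then show V: "levelwise_sum u \<in> V_inf"
    using nonneg_fubini(1)[OF _ row rows] by (simp add: V_inf_iff level)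
  have "(ip_norm V_inf_inner (levelwise_sum u))\<^sup>2 = (\<Sum>\<^sub>\<infinity>q\<in>I. infsum (?f q) UNIV)"
    using nonneg_fubini(2)[OF _ row rows] by (simp add: V_inf_norm_sq[OF V] level)
  also have "\<dots> = (ip_norm (hsum_inner I (\<lambda>_. V_inf_inner)) u)\<^sup>2"
    unfolding orbit_hsum_norm(1)[OF assms] by (intro infsum_cong) (simp add: V_inf_norm_sq u(2))
  finally show "ip_norm V_inf_inner (levelwise_sum u)
      = ip_norm (hsum_inner I (\<lambda>_. V_inf_inner)) u"
    by (rule power2_eq_imp_eq) (auto intro: V_inf_norm_nonneg[OF V] orbit_hsum_norm(2)[OF assms])
qed

lemma levelwise_sum_coefficient:
  assumes "u \<in> orbit_hsum" "q \<in> level_index n"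
  shows "V_inner n (levelwise_sum u n) (b q n) = V_inner n (u q n) (b q n)"
proof -
  have u: "u r \<in> orbit_space r" "u r n \<in> V n" if "r \<in> level_index n" for r
    using assms(1) that by (auto simp: hsum_def level_index_def orbit_space_def V_inf_iff)
  have "V_inner n (levelwise_sum u n) (b q n) = (\<Sum>r\<in>level_index n. V_inner n (u r n) (b q n))"
    using V_inner_sum_left[of "level_index n" "\<lambda>r. u r n" n "\<lambda>_. 1"] u(2)
    by (simp add: levelwise_sum_def scaleC_one)
  also have "\<dots> = (\<Sum>r\<in>level_index n. if r = q then V_inner n (u q n) (b q n) else 0)"
    using u(1) assms(2) by (intro sum.cong) (auto simp: orbit_space_def)
  also have "\<dots> = V_inner n (u q n) (b q n)"
    using assms(2) finite_level_index by simp
  finally show ?thesis .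
qed

text \<open>
  The orthogonal projection of \<open>x\<close> to the orbit space of \<open>q\<close>; as a function of \<open>q\<close> it inverts
  \<open>levelwise_sum\<close>.
\<close>

definition orbit_part :: "(nat \<Rightarrow> nat \<Rightarrow> complex) \<Rightarrow> 'q \<Rightarrow> nat \<Rightarrow> nat \<Rightarrow> complex"
  where "orbit_part x q n =
    (if q \<in> level_index n then V_inner n (x n) (b q n) *\<^sub>C b q n else 0)"

lemma orbit_part_levelwise_sum:
  assumes "u \<in> orbit_hsum"
  shows "orbit_part (levelwise_sum u) = u"
proof (rule ext, rule ext)
  fix q n
  show "orbit_part (levelwise_sum u) q n = u q n"
  proof (cases "q \<in> I")
    case True
    then have "u q \<in> orbit_space q"
      using assms by (simp add: hsum_def)
    from orbit_space_level[OF this True, of n] show ?thesis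
      using True levelwise_sum_coefficient[OF assms, of q n]
      by (auto simp: orbit_part_def level_index_iff)
  next
    case False
    then show ?thesis
      using assms by (simp add: hsum_def orbit_part_def level_index_def)
  qed
qed

lemma levelwise_sum_orbit_part:
  assumes "x \<in> V_inf"
  shows "levelwise_sum (orbit_part x) = x"
proof
  fix n
  have "x n = (\<Sum>q\<in>level_index n. V_inner n (x n) (b q n) *\<^sub>C b q n)"
    using assms by (intro b_expansion V_inf_in_V)
  also have "\<dots> = levelwise_sum (orbit_part x) n"
    by (simp add: levelwise_sum_def orbit_part_def)
  finally show "levelwise_sum (orbit_part x) n = x n" ..
qed

lemma orbit_part_in_orbit_hsum:
  assumes "x \<in> V_inf"
  shows "orbit_part x \<in> orbit_hsum"
proof -
  let ?f = "\<lambda>n q. (ip_norm (V_inner n) (orbit_part x q n))\<^sup>2"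
  have xV: "x n \<in> V n" for n
    using assms by (rule V_inf_in_V)
  have f: "?f n q = (if q \<in> level_index n then (cmod (V_inner n (x n) (b q n)))\<^sup>2 else 0)" for n q
    by (simp add: orbit_part_def b_norm)
  have has_sum: "(?f n has_sum (ip_norm (V_inner n) (x n))\<^sup>2) I" for n
  proof -
    have "(?f n has_sum (\<Sum>q\<in>level_index n. ?f n q)) (level_index n)"
      by (rule has_sum_finite[OF finite_level_index])
    then have "(?f n has_sum (\<Sum>q\<in>level_index n. ?f n q)) I"
      by (subst has_sum_cong_neutral[where T = "level_index n" and g = "?f n"])
         (auto simp: level_index_def orbit_part_def)
    then show ?thesis
      using b_parseval[OF xV, of n] by (simp add: f)
  qed
  have row: "?f n summable_on I" and infsum: "infsum (?f n) I = (ip_norm (V_inner n) (x n))\<^sup>2" for n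
    using has_sum[of n] by (auto simp: summable_on_def infsumI)
  have rows: "(\<lambda>n. infsum (?f n) I) summable_on UNIV"
    using assms by (simp add: infsum V_inf_iff)
  have part: "orbit_part x q \<in> V_inf" if "q \<in> I" for q
  proof -
    have "(\<lambda>n. ?f n q) summable_on UNIV"
    proof (rule summable_on_comparison_test)
      show "(\<lambda>n. infsum (?f n) I) summable_on UNIV"
        by (rule rows)
      show "?f n q \<le> infsum (?f n) I" for n
        using finite_sum_le_infsum[OF row, of "{q}" n] that by simp
    qed simp
    moreover have "orbit_part x q n \<in> V n" for n
      by (simp add: orbit_part_def b_mem V_scaleC)
    ultimately show ?thesis
      by (simp add: V_inf_iff)
  qed
  have "orbit_part x q \<in> orbit_space q" if "q \<in> I" for q
    using part[OF that]
    by (auto simp: orbit_space_def orbit_part_def V_inner_scaleC_left b_mem b_inner)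
  moreover have "(\<lambda>q. (ip_norm V_inf_inner (orbit_part x q))\<^sup>2) summable_on I"
    using nonneg_fubini(1)[OF _ row rows]
    by (subst summable_on_cong[where g = "\<lambda>q. \<Sum>\<^sub>\<infinity>n. ?f n q"])
       (auto simp: V_inf_norm_sq[OF part])
  moreover have "orbit_part x q = 0" if "q \<notin> I" for q
    using that by (auto simp: orbit_part_def level_index_def)
  ultimately show ?thesis
    by (simp add: hsum_def)
qed

text \<open>
  The error of a partial sum over \<open>F\<close> is, up to sign, the levelwise sum of the family with the entries
  in \<open>F\<close> deleted. Since \<open>levelwise_sum\<close> is isometric, its squared norm is the tail of the convergent sum of
  squared norms.
\<close>

lemma norm_has_sum_levelwise_sum:
  assumes u: "u \<in> orbit_hsum"
  shows "norm_has_sum V_inf_inner u I (levelwise_sum u)"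
proof -
  let ?f = "\<lambda>q. (ip_norm V_inf_inner (u q))\<^sup>2"
  have f: "?f summable_on I"
    using u by (simp add: hsum_def)
  have uV: "u q \<in> orbit_space q" "u q \<in> V_inf" if "q \<in> I" for q
    using u orbit_space_subset that by (auto simp: hsum_def)
  have norm: "ip_norm V_inf_inner (sum u F - levelwise_sum u) = sqrt (infsum ?f I - sum ?f F)"
    if F: "finite F" "F \<subseteq> I" for F
  proof -
    define t where "t q = (if q \<in> F then 0 else - u q)" for q
    have t: "t q \<in> orbit_space q" if "q \<in> I" for q
      using uV[OF that] csubspace_orbit_space[of q]
      by (auto simp: t_def intro: complex_vector.subspace_0 complex_vector.subspace_neg)
    have sq: "(ip_norm V_inf_inner (t q))\<^sup>2 = (if q \<in> F then 0 else ?f q)" if "q \<in> I" for q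
      using uV(2)[OF that] V_inf_norm_sq[of 0] csubspace_V_inf
      by (auto simp: t_def V_inf_norm_sq_uminus complex_vector.subspace_0)
    have t_hsum: "t \<in> orbit_hsum"
      using t infsum_off_finite(1)[OF f F] u
      by (auto simp: hsum_def sq cong: summable_on_cong) (auto simp: t_def)
    have "sum u F - levelwise_sum u = levelwise_sum t"
    proof
      fix n
      have "u q n = 0" if "q \<in> F - level_index n" for q
        using orbit_space_level[OF uV(1), of q n] that F(2) by (auto simp: level_index_iff)
      then have "sum u F n = (\<Sum>q\<in>F \<inter> level_index n. u q n)"
        using F(1) by (auto simp: sum_fun_apply intro: sum.mono_neutral_right)
      also have "\<dots> = (\<Sum>q\<in>level_index n. if q \<in> F then u q n else 0)"
        by (subst Int_commute) (rule sum.inter_restrict[OF finite_level_index])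
      finally have "sum u F n - levelwise_sum u n
        = (\<Sum>q\<in>level_index n. (if q \<in> F then u q n else 0) - u q n)"
        by (simp add: levelwise_sum_def sum_subtractf)
      also have "\<dots> = levelwise_sum t n"
        unfolding levelwise_sum_def
        by (intro sum.cong) (auto simp: t_def)
      finally show "(sum u F - levelwise_sum u) n = levelwise_sum t n"
        by simp
    qed
    then have "(ip_norm V_inf_inner (sum u F - levelwise_sum u))\<^sup>2 = infsum ?f I - sum ?f F"
      using levelwise_sum_isometric(2)[OF t_hsum] orbit_hsum_norm(1)[OF t_hsum]
        infsum_off_finite(2)[OF f F] by (simp add: sq cong: infsum_cong)
    moreover have "0 \<le> ip_norm V_inf_inner (sum u F - levelwise_sum u)"
      using V_inf_norm_nonneg[OF levelwise_sum_isometric(1)[OF t_hsum]]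
        \<open>sum u F - levelwise_sum u = levelwise_sum t\<close> by simp
    ultimately show ?thesis
      by (metis real_sqrt_unique)
  qed
  have "((\<lambda>F. sqrt (infsum ?f I - sum ?f F)) \<longlongrightarrow> sqrt (infsum ?f I - infsum ?f I))
      (finite_subsets_at_top I)"
    by (intro tendsto_intros infsum_tendsto f)
  then have "((\<lambda>F. sqrt (infsum ?f I - sum ?f F)) \<longlongrightarrow> 0) (finite_subsets_at_top I)"
    by simp
  then show ?thesis
    unfolding norm_has_sum_def
    by (rule Lim_transform_eventually)
       (auto simp: norm intro!: eventually_finite_subsets_at_top_weakI)
qed

lemma hilbert_sum_map_levelwise_sum:
  "hilbert_sum_map V_inf V_inf_inner I orbit_space levelwise_sum"
  unfolding hilbert_sum_map_def isometric_iso_def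
proof (intro conjI ballI allI)
  show "bij_betw levelwise_sum orbit_hsum V_inf"
    by (rule bij_betwI[where g = orbit_part])
       (auto simp: levelwise_sum_isometric(1) orbit_part_in_orbit_hsum levelwise_sum_orbit_part
         orbit_part_levelwise_sum)
qed (auto simp: closed_subspace_orbit_space norm_has_sum_levelwise_sum levelwise_sum_add
    levelwise_sum_scaleC levelwise_sum_isometric(2))

lemma S_levelwise_sum:
  assumes u: "u \<in> orbit_hsum"
  defines "Su \<equiv> (\<lambda>q. if q \<in> I then restrict S (orbit_space q) (u q) else 0)"
  shows "Su \<in> orbit_hsum" and "S (levelwise_sum u) = levelwise_sum Su"
proof -
  have uV: "u q \<in> orbit_space q" if "q \<in> I" for q
    using u that by (simp add: hsum_def)
  have Su: "Su q = S (u q)" if "q \<in> I" for q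
    using that uV by (simp add: Su_def)
  show "Su \<in> orbit_hsum"
    using u S_orbit_space[OF _ uV] by (auto simp: hsum_def Su cong: summable_on_cong) (simp add: Su_def)
  show "S (levelwise_sum u) = levelwise_sum Su"
  proof
    fix n
    show "S (levelwise_sum u) n = levelwise_sum Su n"
    proof (cases n)
      case 0
      then show ?thesis
        by (simp add: S_def levelwise_sum_def level_index_def Su)
    next
      case (Suc m)
      have "S (levelwise_sum u) n = (\<Sum>q\<in>level_index m. A m (u q m))"
        using uV Suc
        by (simp add: S_def levelwise_sum_def, intro A_sum)
           (auto simp: level_index_def orbit_space_def V_inf_iff)
      also have "\<dots> = (\<Sum>q\<in>level_index (Suc m). A m (u q m))"
      proof (rule sum.mono_neutral_left)
        have "u q m = 0" if "q \<in> level_index (Suc m) - level_index m" for q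
          using orbit_space_level[OF uV, of q m] that by (auto simp: level_index_def)
        then show "\<forall>q\<in>level_index (Suc m) - level_index m. A m (u q m) = 0"
          by simp
      qed (use finite_level_index in \<open>auto simp: level_index_def\<close>)
      also have "\<dots> = levelwise_sum Su n"
        unfolding levelwise_sum_def Suc by (intro sum.cong) (auto simp: level_index_def Su S_def)
      finally show ?thesis .
    qed
  qed
qed

lemma orbit_decomposition:
  "is_operator_direct_sum V_inf V_inf_inner I orbit_space (\<lambda>q. restrict S (orbit_space q)) S"
  unfolding is_operator_direct_sum_def
  using hilbert_sum_map_levelwise_sum S_levelwise_sum by blast

lemma orbit_space_shift:
  assumes "q \<in> I"
  shows "unilateral_shift_wrt (orbit_space q) V_inf_inner
      (\<lambda>i. (S ^^ i) (orbit_sum q (ell2_unit 0))) (restrict S (orbit_space q))"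
    and "isometrically_isomorphic (orbit_space q) V_inf_inner ell2 ell2_inner"
proof -
  note iso = orbit_sum_isometric_iso[OF assms]
  then have "orbit_sum q a \<in> orbit_space q" if "a \<in> ell2" for a
    using that by (auto simp: isometric_iso_def bij_betw_def)
  then show "unilateral_shift_wrt (orbit_space q) V_inf_inner
      (\<lambda>i. (S ^^ i) (orbit_sum q (ell2_unit 0))) (restrict S (orbit_space q))"
    unfolding unilateral_shift_wrt_def using iso
    by (intro exI[of _ "orbit_sum q"]) (simp add: S_orbit_sum assms S_funpow_orbit)
  show "isometrically_isomorphic (orbit_space q) V_inf_inner ell2 ell2_inner"
    unfolding isometrically_isomorphic_def
    using isometric_iso_inverse[OF iso csubspace_ell2] by blast
qed

end

section \<open>Adapted bases from the complements of the ranges\<close>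

text \<open>
  The space \<open>M (k + 1)\<close> as a subspace of \<open>V (k + 1)\<close> instead of \<open>V_inf\<close>. In the theory of isometries
  such complements of the range are called wandering subspaces.
\<close>

definition wandering :: "nat \<Rightarrow> (nat \<Rightarrow> complex) set"
  where "wandering k = {f \<in> V (Suc k). \<forall>g\<in>V k. V_inner (Suc k) f (A k g) = 0}"

text \<open>
  As \<open>A k\<close> is isometric, it maps an orthonormal basis of \<open>V k\<close> to one of its range. Subtracting from
  \<open>f\<close> its projection to the range leaves a vector in the complement, so the two bases together
  span.
\<close>

lemma orthonormal_basis_Suc:
  assumes J: "finite J" "orthonormal_basis (V_inner k) J b (V k)"
    and K: "orthonormal_basis (V_inner (Suc k)) K c (wandering k)"
    and disj: "J \<inter> K = {}"
    and d: "\<And>q. q \<in> J \<Longrightarrow> d q = A k (b q)" "\<And>q. q \<in> K \<Longrightarrow> d q = c q"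
  shows "orthonormal_basis (V_inner (Suc k)) (J \<union> K) d (V (Suc k))"
proof -
  have c: "c q \<in> wandering k" if "q \<in> K" for q
    using K that complex_vector.span_superset[of "c ` K"] by (auto simp: orthonormal_basis_def)
  have bV: "b q \<in> V k" if "q \<in> J" for q
    using onb_mem[OF J that] .
  have JJ: "V_inner (Suc k) (d q) (d r) = (if q = r then 1 else 0)" if "q \<in> J" "r \<in> J" for q r
    using that by (simp add: d A_isometric onb_inner[OF J])
  have KK: "V_inner (Suc k) (d q) (d r) = (if q = r then 1 else 0)" if "q \<in> K" "r \<in> K" for q r
    using that K by (simp add: d orthonormal_basis_def)
  have KJ: "V_inner (Suc k) (d q) (d r) = 0" if "q \<in> K" "r \<in> J" for q r
    using that c bV by (simp add: d wandering_def)
  then have JK: "V_inner (Suc k) (d r) (d q) = 0" if "q \<in> K" "r \<in> J" for q r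
    using that by (subst V_inner_commute) simp
  have orth: "\<forall>q\<in>J \<union> K. \<forall>r\<in>J \<union> K. V_inner (Suc k) (d q) (d r) = (if q = r then 1 else 0)"
    using JJ KK KJ JK disj by auto
  have dV: "d q \<in> V (Suc k)" if "q \<in> J \<union> K" for q
    using that c by (auto simp: d A_in_V wandering_def)
  have "f \<in> cspan (d ` (J \<union> K))" if f: "f \<in> V (Suc k)" for f
  proof -
    define p where "p = (\<Sum>q\<in>J. V_inner (Suc k) f (d q) *\<^sub>C d q)"
    have pV: "p \<in> V (Suc k)"
      unfolding p_def using dV by (intro V_sum V_scaleC) auto
    have "f - p \<in> wandering k"
      unfolding wandering_def
    proof (intro CollectI conjI ballI)
      show "f - p \<in> V (Suc k)"
        using f pV by (rule V_diff)
      \<comment> \<open>It suffices to test against the images of the basis vectors.\<close>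
      have fp: "V_inner (Suc k) (f - p) (d r) = 0" if "r \<in> J" for r
      proof -
        have "V_inner (Suc k) p (d r) = (\<Sum>q\<in>J. V_inner (Suc k) f (d q) * V_inner (Suc k) (d q) (d r))"
          unfolding p_def using dV by (intro V_inner_sum_left) auto
        also have "\<dots> = (\<Sum>q\<in>J. if q = r then V_inner (Suc k) f (d r) else 0)"
          using that by (intro sum.cong) (auto simp: JJ)
        also have "\<dots> = V_inner (Suc k) f (d r)"
          using that J(1) by simp
        finally show ?thesis
          using f pV by (simp add: V_inner_diff_left)
      qed
      fix g
      assume "g \<in> V k"
      then have "A k g = A k (\<Sum>q\<in>J. V_inner k g (b q) *\<^sub>C b q)"
        using onb_expansion[OF J] by simp
      also have "\<dots> = (\<Sum>q\<in>J. V_inner k g (b q) *\<^sub>C d q)"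
        by (simp add: A_sum A_scaleC bV V_scaleC d)
      finally show "V_inner (Suc k) (f - p) (A k g) = 0"
        using dV by (simp add: V_inner_sum_right fp)
    qed
    then have "f - p \<in> cspan (c ` K)"
      using K by (simp add: orthonormal_basis_def)
    also have "c ` K = d ` K"
      using d(2) by simp
    finally have "f - p \<in> cspan (d ` (J \<union> K))"
      by (rule subsetD[OF complex_vector.span_mono, rotated]) auto
    moreover have "p \<in> cspan (d ` (J \<union> K))"
      unfolding p_def
      by (intro complex_vector.span_sum complex_vector.span_scale complex_vector.span_base) auto
    ultimately have "(f - p) + p \<in> cspan (d ` (J \<union> K))"
      by (rule complex_vector.span_add)
    then show ?thesis
      by simp
  qed
  moreover have "cspan (d ` (J \<union> K)) \<subseteq> V (Suc k)"
    using dV by (intro complex_vector.span_minimal csubspace_V) auto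
  ultimately show ?thesis
    using orth by (auto simp: orthonormal_basis_def)
qed

lemma orthonormal_basis_V_0:
  assumes "f \<in> V 0" "ip_norm (V_inner 0) f = 1"
  shows "orthonormal_basis (V_inner 0) {q} (\<lambda>_. f) (V 0)"
proof -
  define c where "c = coord 0 f 1"
  have f: "f = c *\<^sub>C Omega 1 0"
    using V_expansion[OF assms(1)] by (simp add: c_def)
  have "(cmod c)\<^sup>2 = 1"
    using V_norm_sq[of 0 f] assms(2) by (simp add: c_def)
  then have "c \<noteq> 0"
    by auto
  then have "Omega 1 0 = inverse c *\<^sub>C f"
    by (simp add: f scaleC_scaleC scaleC_one)
  then have "Omega 1 0 \<in> cspan {f}"
    by (simp add: complex_vector.span_base complex_vector.span_scale)
  then have "V 0 \<subseteq> cspan {f}"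
    unfolding V_def Omega_basis_def by (intro complex_vector.span_minimal) auto
  moreover have "cspan {f} \<subseteq> V 0"
    using assms(1) by (intro complex_vector.span_minimal csubspace_V) auto
  ultimately show ?thesis
    using V_inner_self[of 0 f] assms(2) by (auto simp: orthonormal_basis_def)
qed

lemma V_in_iff: "x \<in> V_in k \<longleftrightarrow> x k \<in> V k \<and> (\<forall>i. i \<noteq> k \<longrightarrow> x i = 0)"
proof
  show "x \<in> V_in k" if "x k \<in> V k \<and> (\<forall>i. i \<noteq> k \<longrightarrow> x i = 0)"
    unfolding V_in_def using that by (intro image_eqI[of _ _ "x k"]) auto
qed (auto simp: V_in_def)

lemma V_inf_inner_V_in:
  assumes "x \<in> V_in k"
  shows "V_inf_inner x y = V_inner k (x k) (y k)"
proof -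
  have "V_inf_inner x y = (\<Sum>\<^sub>\<infinity>i\<in>{k}. V_inner i (x i) (y i))"
    unfolding V_inf_inner_def hsum_inner_def
    using assms by (intro infsum_cong_neutral) (auto simp: V_in_iff)
  then show ?thesis
    by simp
qed

lemma S_V_in:
  assumes "x \<in> V_in k"
  shows "S x \<in> V_in (Suc k)" and "S x (Suc k) = A k (x k)"
  using assms by (auto simp: V_in_iff S_def A_in_V split: nat.split)

lemma S_funpow_V_in: "x \<in> V_in k \<Longrightarrow> (S ^^ i) x \<in> V_in (k + i)"
  by (induction i) (auto simp: S_V_in)

lemma M_Suc_iff: "x \<in> M (Suc k) \<longleftrightarrow> x \<in> V_in (Suc k) \<and> x (Suc k) \<in> wandering k"
proof -
  have "(\<forall>y\<in>S ` V_in k. V_inf_inner x y = 0) \<longleftrightarrow> (\<forall>g\<in>V k. V_inner (Suc k) (x (Suc k)) (A k g) = 0)"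
    if x: "x \<in> V_in (Suc k)"
  proof -
    have "V_inf_inner x (S y) = V_inner (Suc k) (x (Suc k)) (A k (y k))" if "y \<in> V_in k" for y
      using x S_V_in(2)[OF that] by (simp add: V_inf_inner_V_in)
    then have "(\<forall>y\<in>S ` V_in k. V_inf_inner x y = 0)
        \<longleftrightarrow> (\<forall>g\<in>(\<lambda>y. y k) ` V_in k. V_inner (Suc k) (x (Suc k)) (A k g) = 0)"
      by simp
    also have "(\<lambda>y. y k) ` V_in k = V k"
      by (simp add: V_in_def image_image)
    finally show ?thesis .
  qed
  then show ?thesis
    by (auto simp: M_def wandering_def V_in_iff)
qed

lemma orthonormal_basis_wandering:
  assumes "orthonormal_basis V_inf_inner K c (M (Suc k))"
  shows "orthonormal_basis (V_inner (Suc k)) K (\<lambda>q. c q (Suc k)) (wandering k)"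
proof -
  have c: "c q \<in> M (Suc k)" if "q \<in> K" for q
    using assms that complex_vector.span_superset[of "c ` K"] by (auto simp: orthonormal_basis_def)
  have "V_inner (Suc k) (c q (Suc k)) (c r (Suc k)) = (if q = r then 1 else 0)"
    if "q \<in> K" "r \<in> K" for q r
    using assms c[OF that(1)] that V_inf_inner_V_in[of "c q" "Suc k" "c r"]
    by (simp add: orthonormal_basis_def M_Suc_iff)
  moreover have "cspan ((\<lambda>q. c q (Suc k)) ` K) = wandering k"
  proof
    have "csubspace (wandering k)"
      by (rule complex_vector.subspaceI)
         (auto simp: wandering_def V_add V_scaleC V_inner_add_left V_inner_scaleC_left)
    then show "cspan ((\<lambda>q. c q (Suc k)) ` K) \<subseteq> wandering k"
      using c by (intro complex_vector.span_minimal) (auto simp: M_Suc_iff)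
    have "cspan (c ` K) \<subseteq> {x. x (Suc k) \<in> cspan ((\<lambda>q. c q (Suc k)) ` K)}"
      by (intro complex_vector.span_minimal complex_vector.subspaceI)
         (auto simp: complex_vector.span_base complex_vector.span_zero complex_vector.span_add
           complex_vector.span_scale scaleC_fun_def[where 'b = "nat \<Rightarrow> complex"])
    then have sub: "M (Suc k) \<subseteq> {x. x (Suc k) \<in> cspan ((\<lambda>q. c q (Suc k)) ` K)}"
      using assms by (simp add: orthonormal_basis_def)
    show "wandering k \<subseteq> cspan ((\<lambda>q. c q (Suc k)) ` K)"
    proof
      fix f
      assume "f \<in> wandering k"
      then have "(\<lambda>i. if i = Suc k then f else 0) \<in> M (Suc k)"
        by (simp add: M_Suc_iff V_in_iff wandering_def)
      with sub show "f \<in> cspan ((\<lambda>q. c q (Suc k)) ` K)"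
        by auto
    qed
  qed
  ultimately show ?thesis
    by (simp add: orthonormal_basis_def)
qed

lemma index_set_0: "{q \<in> index_set. snd q \<le> 0} = {(1, 0)}"
  by (auto simp: index_set_def)

lemma index_set_Suc:
  "{q \<in> index_set. snd q \<le> Suc n} = {q \<in> index_set. snd q \<le> n} \<union> (\<lambda>j. (j, Suc n)) ` {1..2 ^ n}"
  by (auto simp: index_set_def le_Suc_eq)

lemma finite_index_set_level: "finite {q \<in> index_set. snd q \<le> n}"
proof (induction n)
  case 0
  show ?case
    unfolding index_set_0 by simp
next
  case (Suc n)
  then show ?case
    unfolding index_set_Suc by simp
qed

section \<open>The decomposition of \<open>V_inf\<close>\<close>

text \<open>
  The spaces and operators are given as functions on all pairs, but are determined only on the index
  set.
\<close>

lemma is_operator_direct_sum_cong: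
  assumes "\<And>i. i \<in> I \<Longrightarrow> W i = W' i" "\<And>i. i \<in> I \<Longrightarrow> R i = R' i"
  shows "is_operator_direct_sum X p I W R T \<longleftrightarrow> is_operator_direct_sum X p I W' R' T"
proof -
  have hsum: "hsum I W (\<lambda>_. p) = hsum I W' (\<lambda>_. p)"
    using assms(1) by (auto simp: hsum_def)
  have "hilbert_sum_map X p I W U = hilbert_sum_map X p I W' U" for U
    using assms(1) by (simp add: hilbert_sum_map_def hsum)
  moreover have "(\<lambda>i. if i \<in> I then R i (u i) else 0) = (\<lambda>i. if i \<in> I then R' i (u i) else 0)" for u
    using assms(2) by auto
  ultimately show ?thesis
    by (simp add: is_operator_direct_sum_def hsum)
qed

theorem proposition9p3:
  fixes e :: "nat \<Rightarrow> nat \<Rightarrow> nat \<Rightarrow> nat \<Rightarrow> complex"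
    and H :: "nat \<Rightarrow> nat \<Rightarrow> (nat \<Rightarrow> nat \<Rightarrow> complex) set"
  assumes "e 1 0 \<in> V_in 0" and "ip_norm V_inf_inner (e 1 0) = 1"
    and "\<And>k. k \<ge> 1 \<Longrightarrow>
      orthonormal_basis V_inf_inner {1..2 ^ (k - 1)} (\<lambda>j. e j k) (M k)"
    and "\<And>j k. (j, k) \<in> index_set \<Longrightarrow>
      H j k = closed_span (range (\<lambda>i. (S ^^ i) (e j k)))"
  shows "(\<forall>(j, k) \<in> index_set.
        closed_subspace V_inf V_inf_inner (H j k) \<and>
        S ` H j k \<subseteq> H j k \<and>
        isometrically_isomorphic (H j k) V_inf_inner ell2 ell2_inner \<and>
        unilateral_shift_wrt (H j k) V_inf_inner (\<lambda>i. (S ^^ i) (e j k)) (restrict S (H j k)))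
    \<and> is_hilbert_direct_sum V_inf V_inf_inner index_set (\<lambda>(j, k). H j k)
    \<and> is_operator_direct_sum V_inf V_inf_inner index_set (\<lambda>(j, k). H j k)
        (\<lambda>(j, k). restrict S (H j k)) S"
proof -
  \<comment> \<open>The vector that the orbit of \<open>e\<^sub>j\<^sub>k\<close> has on level \<open>n\<close>, for \<open>q = (j, k)\<close>.\<close>
  define b where "b q n = (S ^^ (n - snd q)) (e (fst q) (snd q)) n" for q n
  have e_Suc: "orthonormal_basis V_inf_inner {1..2 ^ k} (\<lambda>j. e j (Suc k)) (M (Suc k))" for k
    using assms(3)[of "Suc k"] by simp
  have e_in: "e j k \<in> V_in k" if jk: "(j, k) \<in> index_set" for j k
  proof (cases k)
    case 0
    then show ?thesis
      using jk assms(1) by (auto simp: index_set_def)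
  next
    case (Suc m)
    then have "j \<in> {1..2 ^ m}"
      using jk by (auto simp: index_set_def)
    then have "e j (Suc m) \<in> M (Suc m)"
      using e_Suc[of m] complex_vector.span_superset[of "(\<lambda>j. e j (Suc m)) ` {1..2 ^ m}"]
      by (auto simp: orthonormal_basis_def)
    then show ?thesis
      using Suc by (simp add: M_Suc_iff)
  qed
  have b_Suc: "b q (Suc n) = A n (b q n)" if "q \<in> index_set" "snd q \<le> n" for q n
  proof -
    have "(S ^^ (n - snd q)) (e (fst q) (snd q)) \<in> V_in n"
      using S_funpow_V_in[OF e_in, of "fst q" "snd q" "n - snd q"] that by simp
    then show ?thesis
      using that(2) by (simp add: b_def Suc_diff_le S_V_in(2))
  qed
  have basis: "orthonormal_basis (V_inner n) {q \<in> index_set. snd q \<le> n} (\<lambda>q. b q n) (V n)" for n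
  proof (induction n)
    case 0
    have "ip_norm (V_inner 0) (e 1 0 0) = 1"
      using assms(1,2) by (simp add: ip_norm_def V_inf_inner_V_in)
    then have "orthonormal_basis (V_inner 0) {(1, 0)} (\<lambda>_. e 1 0 0) (V 0)"
      using assms(1) by (intro orthonormal_basis_V_0) (auto simp: V_in_iff)
    then show ?case
      unfolding index_set_0 by (simp add: orthonormal_basis_def b_def)
  next
    case (Suc n)
    have "orthonormal_basis (V_inner (Suc n)) {1..2 ^ n} (\<lambda>j. e j (Suc n) (Suc n)) (wandering n)"
      using e_Suc by (rule orthonormal_basis_wandering)
    then have "orthonormal_basis (V_inner (Suc n)) ((\<lambda>j. (j, Suc n)) ` {1..2 ^ n})
        (\<lambda>q. e (fst q) (Suc n) (Suc n)) (wandering n)"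
      by (simp add: orthonormal_basis_def image_image)
    then show ?case
      unfolding index_set_Suc
      by (rule orthonormal_basis_Suc[OF finite_index_set_level Suc.IH])
         (auto simp: b_Suc, auto simp: b_def)
  qed
  interpret shift_basis index_set snd b
    by unfold_locales (auto simp: b_Suc basis finite_index_set_level)
  \<comment> \<open>The starting vector lives on level \<open>k\<close> only, so it is the orbit sum of the first unit sequence.\<close>
  have start: "orbit_sum (j, k) (ell2_unit 0) = e j k" if "(j, k) \<in> index_set" for j k
  proof
    fix n
    have "e j k n = 0" if "n \<noteq> k"
      using e_in[OF \<open>(j, k) \<in> index_set\<close>] that by (simp add: V_in_iff)
    then show "orbit_sum (j, k) (ell2_unit 0) n = e j k n"
      by (auto simp: orbit_sum_def ell2_unit_def b_def scaleC_one)
  qed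
  have H: "H j k = orbit_space (j, k)" if "(j, k) \<in> index_set" for j k
    using assms(4)[OF that] closed_span_orbit[OF that] start[OF that] by simp
  have decomposition: "is_operator_direct_sum V_inf V_inf_inner index_set (\<lambda>(j, k). H j k)
        (\<lambda>(j, k). restrict S (H j k)) S"
    using orbit_decomposition
    by (rule is_operator_direct_sum_cong[THEN iffD1, rotated 2]) (auto simp: H)
  moreover have "is_hilbert_direct_sum V_inf V_inf_inner index_set (\<lambda>(j, k). H j k)"
    using decomposition by (auto simp: is_operator_direct_sum_def is_hilbert_direct_sum_def)
  moreover have "closed_subspace V_inf V_inf_inner (H j k) \<and>
        S ` H j k \<subseteq> H j k \<and>
        isometrically_isomorphic (H j k) V_inf_inner ell2 ell2_inner \<and>
        unilateral_shift_wrt (H j k) V_inf_inner (\<lambda>i. (S ^^ i) (e j k)) (restrict S (H j k))"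
    if jk: "(j, k) \<in> index_set" for j k
    using orbit_space_shift[OF jk] closed_subspace_orbit_space[of "(j, k)"] S_orbit_space(1)[OF jk]
    by (auto simp: H[OF jk] start[OF jk])
  ultimately show ?thesis
    by blast
qed

end
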